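(* Let $\mathbf{w}\in\mathcal{V}$ have length $k$. The canonical triangulation of $\mathcal{O}(Q_{\mathbf{w}})$ admits exactly $k+1$ flips.
   Context: A generalized snake word of length $n\ge 0$ is a word $\mathbf{w}=w_0w_1\cdots w_n$ where $w_0=\varepsilon$ is the empty letter and $w_i\in\{L,R\}$ for $1\le i\le n$. $\mathcal{V}$ is the set of generalized snake words that do not contain $LRL$ or $RLR$ as a (contiguous) substring. The generalized snake poset $P(\mathbf{w})$ is defined recursively ($\prec$ denotes a cover relation). $P(\varepsilon)$ is the poset on $\{0,1,2,3\}$ with cover relations $1\prec 0$, $2\prec 0$, $3\prec 1$, $3\prec 2$. For $n\ge 1$, $P(w_0\cdots w_n)$ is $P(w_0\cdots w_{n-1})\cup\{2n+2,2n+3\}$ with the added cover relations $2n+3\prec 2n+1$, $2n+3\prec 2n+2$, and: $2n+2\prec 2n-1$ if ($n=1$ and $w_n=L$) or ($n\ge2$ and $w_{n-1}w_n\in\{RL,LR\}$); $2n+2\prec 2n$ if ($n=1$ and $w_n=R$) or ($n\ge 2$ and $w_{n-1}w_n\in\{LL,RR\}$). Let $\widehat{P}(\mathbf{w})$ be $P(\mathbf{w})$ with a new minimum $\widehat 0$ and a new maximum $\widehat 1$ adjoined; it is a distributive lattice. $Q_{\mathbf{w}}$ is the poset of meet-irreducible elements of $\widehat P(\mathbf{w})$ (elements $\ne\widehat 1$ covered by exactly one element), with the induced order. For a finite poset $Q$, the order polytope is $\mathcal{O}(Q)=\{x\in[0,1]^Q: x_i\le x_j \text{ whenever } i<_Q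 j\}$; its vertices are the indicator vectors $\mathbf{v}_A$ of the filters (upper order ideals) $A$ of $Q$. Triangulations of $\mathcal{O}(Q)$ are triangulations of its vertex set: collections of full-dimensional simplices with vertices among the vertices of $\mathcal{O}(Q)$, with union $\mathcal{O}(Q)$, any two meeting in a common face. The canonical triangulation is the one induced by the hyperplanes $x_i=x_j$ ($i\neq j$); its maximal simplices are the convex hulls of $\{\mathbf{v}_{A}\}$ with $A$ ranging over a maximal chain of filters of $Q$. A circuit $Z$ of a point configuration is a minimal affinely dependent subset; its unique affine dependence gives a partition $Z=Z_+\sqcup Z_-$ by sign of coefficients. $Z$ has exactly two triangulations $\mathcal{T}_Z^{\pm}$, with maximal simplices $Z\setminus\{z\}$, $z\in Z_{\pm}$. A triangulation $\mathcal{T}_1$ (viewed as a simplicial complex) can be flipped at $Z$, giving $\mathcal{T}_2$, if (up to exchanging $Z_+$ and $Z_-$) $\mathcal{T}_1$ contains $\mathcal{T}_Z^+$, all maximal simplices of $\mathcal{T}_Z^+$ have the same link $\mathrm{L}$ in $\mathcal{T}_1$, and $\mathcal{T}_2$ is obtained from $\mathcal{T}_1$ by replacing $\mathcal{T}_Z^+*\mathrm{L}$ by $\mathcal{T}_Z^-*\mathrm{L}$ (with $*$ the join). The number of flips a triangulation admits is the number of triangulations that differ from it by a flip. *)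

theory Defs
  imports "HOL-Analysis.Analysis" "HOL-Analysis.Finite_Function_Topology" "HOL-Library.Sublist"
begin

section \<open>Generalized snake posets\<close>

datatype letter = L | R

text \<open>
  A generalized snake word \<open>w\<^sub>0 w\<^sub>1 \<dots> w\<^sub>n\<close> is the list of its letters \<open>w\<^sub>1, \<dots>, w\<^sub>n\<close>; the empty letter
  \<open>w\<^sub>0\<close> is left out, so that \<open>w\<^sub>i\<close> is \<open>w ! (i - 1)\<close>.
\<close>

definition snake_words :: "letter list set" where
  "snake_words = {w. \<not> sublist [L, R, L] w \<and> \<not> sublist [R, L, R] w}"

text \<open>
  \<open>snake_covers w n\<close> is the cover relation of \<open>P(w\<^sub>0 \<dots> w\<^sub>n)\<close>, for \<open>n \<le> length w\<close>. A pair \<open>(x, y)\<close>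
  means that \<open>x\<close> is covered by \<open>y\<close>.
\<close>

fun snake_covers :: "letter list \<Rightarrow> nat \<Rightarrow> nat rel" where
  "snake_covers w 0 = {(1, 0), (2, 0), (3, 1), (3, 2)}"
| "snake_covers w (Suc m) =
    (let n = Suc m;
         turn = (if n = 1 then w ! 0 = L else w ! (n - 2) \<noteq> w ! (n - 1))
     in snake_covers w m \<union>
        {(2 * n + 3, 2 * n + 1), (2 * n + 3, 2 * n + 2),
         (2 * n + 2, if turn then 2 * n - 1 else 2 * n)})"

definition snake_carrier :: "letter list \<Rightarrow> nat set" where
  "snake_carrier w = {..2 * length w + 3}"

definition snake_order :: "letter list \<Rightarrow> nat rel" where
  "snake_order w = Restr ((snake_covers w (length w))\<^sup>*) (snake_carrier w)"

datatype 'a hat = Zero_hat | Elem 'a | One_hat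

definition hat_carrier :: "'a set \<Rightarrow> 'a hat set" where
  "hat_carrier A = {Zero_hat, One_hat} \<union> Elem ` A"

definition hat_order :: "'a set \<Rightarrow> 'a rel \<Rightarrow> 'a hat rel" where
  "hat_order A r =
    {Zero_hat} \<times> hat_carrier A \<union> hat_carrier A \<times> {One_hat} \<union> {(Elem x, Elem y) | x y. (x, y) \<in> r}"

definition is_covered_by :: "'a set \<Rightarrow> 'a rel \<Rightarrow> 'a \<Rightarrow> 'a \<Rightarrow> bool" where
  "is_covered_by A r x y \<longleftrightarrow>
    x \<in> A \<and> y \<in> A \<and> x \<noteq> y \<and> (x, y) \<in> r \<and>
    \<not> (\<exists>z\<in>A. z \<noteq> x \<and> z \<noteq> y \<and> (x, z) \<in> r \<and> (z, y) \<in> r)"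

definition Q_carrier :: "letter list \<Rightarrow> nat hat set" where
  "Q_carrier w =
    {x \<in> hat_carrier (snake_carrier w). x \<noteq> One_hat \<and>
       (\<exists>!y. is_covered_by (hat_carrier (snake_carrier w))
               (hat_order (snake_carrier w) (snake_order w)) x y)}"

definition Q_order :: "letter list \<Rightarrow> nat hat rel" where
  "Q_order w = Restr (hat_order (snake_carrier w) (snake_order w)) (Q_carrier w)"


section \<open>Order polytopes\<close>

text \<open>
  For a finite set \<open>A\<close>, the space \<open>\<real>\<^sup>A\<close> is the subspace of the vectors supported on \<open>A\<close> in the real
  vector space \<open>'a \<Rightarrow>\<^sub>0 real\<close> of finitely supported functions.
\<close>

definition order_polytope :: "'a set \<Rightarrow> 'a rel \<Rightarrow> ('a \<Rightarrow>\<^sub>0 real) set" where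
  "order_polytope A r =
    {x. Poly_Mapping.keys x \<subseteq> A \<and>
        (\<forall>i\<in>A. 0 \<le> Poly_Mapping.lookup x i \<and> Poly_Mapping.lookup x i \<le> 1) \<and>
        (\<forall>i\<in>A. \<forall>j\<in>A. i \<noteq> j \<and> (i, j) \<in> r \<longrightarrow> Poly_Mapping.lookup x i \<le> Poly_Mapping.lookup x j)}"

definition order_filters :: "'a set \<Rightarrow> 'a rel \<Rightarrow> 'a set set" where
  "order_filters A r = {F. F \<subseteq> A \<and> (\<forall>i\<in>F. \<forall>j\<in>A. (i, j) \<in> r \<longrightarrow> j \<in> F)}"

definition indicator_vector :: "'a set \<Rightarrow> ('a \<Rightarrow>\<^sub>0 real)" where
  "indicator_vector F = (\<Sum>i\<in>F. Poly_Mapping.single i 1)"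


section \<open>Triangulations of the vertex set of a polytope\<close>

text \<open>
  A simplex is given by its set of vertices, a triangulation by the set of its maximal simplices.
\<close>

definition vertices :: "'v::real_vector set \<Rightarrow> 'v set" where
  "vertices P = {v. v extreme_point_of P}"

text \<open>
  A simplex with vertices in \<open>P\<close> is full-dimensional iff its affine hull is that of \<open>P\<close>.
\<close>

definition vertex_triangulation :: "'v::real_vector set \<Rightarrow> 'v set set \<Rightarrow> bool" where
  "vertex_triangulation P T \<longleftrightarrow>
    (\<forall>S\<in>T. S \<subseteq> vertices P \<and> finite S \<and> \<not> affine_dependent S \<and> affine hull S = affine hull P) \<and>
    (\<Union>S\<in>T. convex hull S) = P \<and>
    (\<forall>S\<in>T. \<forall>S'\<in>T. (convex hull S \<inter> convex hull S') face_of (convex hull S) \<and>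
                    (convex hull S \<inter> convex hull S') face_of (convex hull S'))"

text \<open>
  The cells cut out of the order polytope by the hyperplanes \<open>x\<^sub>i = x\<^sub>j\<close> are the simplices spanned by
  the indicator vectors of the members of a maximal chain of filters (the empty filter and the
  whole poset included).
\<close>

definition canonical_triangulation :: "'a set \<Rightarrow> 'a rel \<Rightarrow> ('a \<Rightarrow>\<^sub>0 real) set set" where
  "canonical_triangulation A r =
    {indicator_vector ` C | C. subset.maxchain (order_filters A r) C}"


section \<open>Flips\<close>

definition faces :: "'v set set \<Rightarrow> 'v set set" where
  "faces T = {F. \<exists>S\<in>T. F \<subseteq> S}"

definition link :: "'v set set \<Rightarrow> 'v set \<Rightarrow> 'v set set" where
  "link K S = {F \<in> K. F \<inter> S = {} \<and> F \<union> S \<in> K}"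

definition join :: "'v set set \<Rightarrow> 'v set set \<Rightarrow> 'v set set" where
  "join K K' = {F \<union> G | F G. F \<in> K \<and> G \<in> K'}"

definition circuit :: "'v::real_vector set \<Rightarrow> bool" where
  "circuit Z \<longleftrightarrow> finite Z \<and> affine_dependent Z \<and> (\<forall>Y. Y \<subset> Z \<longrightarrow> \<not> affine_dependent Y)"

text \<open>
  The affine dependence of a circuit is unique only up to a nonzero factor, so both
  \<open>circuit_signs Z X Y\<close> and \<open>circuit_signs Z Y X\<close> hold for the two sign classes \<open>X\<close>, \<open>Y\<close> of \<open>Z\<close>.
\<close>

definition circuit_signs :: "'v::real_vector set \<Rightarrow> 'v set \<Rightarrow> 'v set \<Rightarrow> bool" where
  "circuit_signs Z Zp Zm \<longleftrightarrow>
    (\<exists>c :: 'v \<Rightarrow> real. (\<Sum>z\<in>Z. c z) = 0 \<and> (\<Sum>z\<in>Z. c z *\<^sub>R z) = 0 \<and> (\<exists>z\<in>Z. c z \<noteq> 0) \<and>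
       Zp = {z \<in> Z. c z > 0} \<and> Zm = {z \<in> Z. c z < 0})"

definition circuit_triangulation :: "'v set \<Rightarrow> 'v set \<Rightarrow> 'v set set" where
  "circuit_triangulation Z X = {Z - {z} | z. z \<in> X}"

definition differ_by_flip :: "'v::real_vector set \<Rightarrow> 'v set set \<Rightarrow> 'v set set \<Rightarrow> bool" where
  "differ_by_flip P T1 T2 \<longleftrightarrow>
    (\<exists>Z Zp Zm K. Z \<subseteq> vertices P \<and> circuit Z \<and> circuit_signs Z Zp Zm \<and>
       faces (circuit_triangulation Z Zp) \<subseteq> faces T1 \<and>
       (\<forall>S\<in>circuit_triangulation Z Zp. link (faces T1) S = K) \<and>
       faces T2 = (faces T1 - join (faces (circuit_triangulation Z Zp)) K)
                  \<union> join (faces (circuit_triangulation Z Zm)) K)"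

definition number_of_flips :: "'v::real_vector set \<Rightarrow> 'v set set \<Rightarrow> nat" where
  "number_of_flips P T = card {T'. vertex_triangulation P T' \<and> differ_by_flip P T T'}"

end

theory Submission
  imports Defs
begin

text \<open>
  The circuits at which the canonical triangulation can be flipped are exactly the parallelograms
  \<open>M, M \<union> {a}, M \<union> {b}, M \<union> {a, b}\<close> of filters: if removing any positive vertex of a circuit leaves
  a chain, the positive part is a pair of incomparable filters \<open>p\<close>, \<open>q\<close>, the negative part consists of
  \<open>p \<inter> q\<close> and \<open>p \<union> q\<close>, and equality of the links forces \<open>p\<close> and \<open>q\<close> to cover \<open>p \<inter> q\<close>. Every such
  parallelogram does give a triangulation, since moving weight along \<open>p + q = (p \<inter> q) + (p \<union> q)\<close>
  translates between barycentric coordinates before and after the flip. In a poset of width two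
  there is exactly one parallelogram for every incomparable pair \<open>a\<close>, \<open>b\<close>. The poset \<open>Q\<close> of a word of
  length \<open>k\<close> consists of the minimum and the elements \<open>0, 1, 2, 4, \<dots>, 2 k + 2\<close>, and each of the
  \<open>k + 1\<close> elements \<open>2 i + 2\<close> is incomparable to exactly one smaller element.
\<close>

section \<open>Triangulations from unique barycentric weights\<close>

text \<open>The obstacle is that \<open>vertex_triangulation\<close> asks for affine independence
  and for face-to-face intersections, which are awkward to check simplex by simplex. Both follow
  from one property of a simplicial complex on a finite vertex set: nonnegative weights supported on
  a face are determined by their total and their weighted sum of vectors. Existence of such weights
  gives the covering. For chains of filters uniqueness and existence are proved directly; for a
  flipped complex both are inherited, because the two complexes differ by a single affine
  dependence. The same uniqueness pins down the circuits: the negative part of a flippable circuit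
  and an explicit weighting on intersection and union represent one vector by chains, so they agree.
  Since \<open>number_of_flips\<close> counts triangulations and not circuits, a flipped complex
  must also remember its parallelogram; it does, because it has only one edge with incomparable
  ends.\<close>

definition weighting :: "'v set set \<Rightarrow> ('v \<Rightarrow> real) \<Rightarrow> bool" where
  "weighting K c \<longleftrightarrow> (\<forall>v. 0 \<le> c v) \<and> {v. c v \<noteq> 0} \<in> K"

text \<open>Totals are compared rather than fixed to 1, so that the two halves of an affine
  dependence can be compared without normalising. The total is a condition of its own because the
  empty filter is the zero vector, whose weight the vector sum cannot see.\<close>

definition unique_weights :: "'v::real_vector set \<Rightarrow> 'v set set \<Rightarrow> bool" where
  "unique_weights V K \<longleftrightarrow>
    (\<forall>c d. weighting K c \<and> weighting K d \<and> sum c V = sum d V \<and>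
       (\<Sum>v\<in>V. c v *\<^sub>R v) = (\<Sum>v\<in>V. d v *\<^sub>R v) \<longrightarrow> c = d)"

lemma unique_weightsD:
  assumes "unique_weights V K" "weighting K c" "weighting K d" "sum c V = sum d V"
    "(\<Sum>v\<in>V. c v *\<^sub>R v) = (\<Sum>v\<in>V. d v *\<^sub>R v)"
  shows "c = d"
  using assms unfolding unique_weights_def by blast

lemma sum_supported:
  fixes c :: "'v::real_vector \<Rightarrow> real"
  assumes "finite V" "S \<subseteq> V" "\<And>v. v \<notin> S \<Longrightarrow> c v = 0"
  shows "sum c V = sum c S" "(\<Sum>v\<in>V. c v *\<^sub>R v) = (\<Sum>v\<in>S. c v *\<^sub>R v)"
  using assms by (auto intro!: sum.mono_neutral_right)

text \<open>Extending barycentric coordinates by zero to all of \<open>V\<close> makes coordinates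
  with respect to different simplices comparable as functions.\<close>

lemma convex_hull_weights:
  fixes V :: "'v::real_vector set"
  assumes "finite V" "S \<subseteq> V"
  shows "x \<in> convex hull S \<longleftrightarrow>
    (\<exists>c. (\<forall>v. 0 \<le> c v) \<and> {v. c v \<noteq> 0} \<subseteq> S \<and> sum c V = 1 \<and> (\<Sum>v\<in>V. c v *\<^sub>R v) = x)"
    (is "_ \<longleftrightarrow> ?R")
proof
  assume "x \<in> convex hull S"
  then obtain u where u: "\<forall>v\<in>S. 0 \<le> u v" "sum u S = 1" "(\<Sum>v\<in>S. u v *\<^sub>R v) = x"
    using convex_hull_finite[of S] assms finite_subset by blast
  define c where "c v = (if v \<in> S then u v else 0)" for v
  have "sum c S = 1" "(\<Sum>v\<in>S. c v *\<^sub>R v) = x"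
    using u by (auto simp: c_def)
  moreover have "c v = 0" if "v \<notin> S" for v using that by (simp add: c_def)
  note sum_supported[of V S c, OF assms this]
  ultimately show ?R
    using u(1) by (intro exI[of _ c]) (auto simp: c_def)
next
  assume ?R
  then obtain c where c: "\<forall>v. 0 \<le> c v" "{v. c v \<noteq> 0} \<subseteq> S" "sum c V = 1" "(\<Sum>v\<in>V. c v *\<^sub>R v) = x"
    by blast
  have "c v = 0" if "v \<notin> S" for v using that c(2) by blast
  note sum_supported[of V S c, OF assms this]
  moreover have "finite S" using assms finite_subset by blast
  ultimately show "x \<in> convex hull S"
    using c by (subst convex_hull_finite) auto
qed

text \<open>The positive and the negative part of an affine dependence on \<open>S\<close> are
  weightings on subsets of \<open>S\<close> with the same total and the same vector sum. Uniqueness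
  makes them equal, so the dependence, which is their difference, vanishes.\<close>

lemma unique_weights_affine_independent:
  fixes V :: "'v::real_vector set"
  assumes "finite V" "S \<subseteq> V" "Pow S \<subseteq> K" "unique_weights V K"
  shows "\<not> affine_dependent S"
proof
  assume dep: "affine_dependent S"
  have fS: "finite S" using assms finite_subset by blast
  then obtain U where U: "sum U S = 0" "\<exists>v\<in>S. U v \<noteq> 0" "(\<Sum>v\<in>S. U v *\<^sub>R v) = 0"
    using dep affine_dependent_explicit_finite by blast
  define c where "c v = (if v \<in> S then max 0 (U v) else 0)" for v
  define d where "d v = (if v \<in> S then max 0 (- U v) else 0)" for v
  have cd: "c v - d v = U v" if "v \<in> S" for v using that by (auto simp: c_def d_def)
  have w: "weighting K c" "weighting K d"
    using assms(3) by (auto simp: weighting_def c_def d_def subset_iff)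
  have "c v = 0" "d v = 0" if "v \<notin> S" for v using that by (simp_all add: c_def d_def)
  note sums = sum_supported[of V S c, OF assms(1,2) this(1)]
    sum_supported[of V S d, OF assms(1,2) this(2)]
  have "sum c S - sum d S = sum U S"
    unfolding sum_subtractf[symmetric] using cd by simp
  moreover have "(\<Sum>v\<in>S. c v *\<^sub>R v) - (\<Sum>v\<in>S. d v *\<^sub>R v) = (\<Sum>v\<in>S. U v *\<^sub>R v)"
    unfolding sum_subtractf[symmetric] scaleR_diff_left[symmetric] using cd by simp
  ultimately have "c = d"
    using U sums by (intro unique_weightsD[OF assms(4) w]) auto
  with cd U(2) show False by auto
qed

text \<open>If \<open>x\<close> lies in both hulls and strictly between points \<open>a\<close>,
  \<open>b\<close> of the hull of \<open>S\<close>, its weights on \<open>S'\<close> must be the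
  proper convex combination of those of \<open>a\<close> and \<open>b\<close>. Nonnegative terms
  cannot cancel, so \<open>a\<close> and \<open>b\<close> are supported on \<open>S'\<close> as
  well.\<close>

lemma unique_weights_hull_Int_face:
  fixes V :: "'v::real_vector set"
  assumes V: "finite V" "S \<subseteq> V" "S' \<subseteq> V" and K: "Pow S \<subseteq> K" "Pow S' \<subseteq> K"
    and uniq: "unique_weights V K"
  shows "(convex hull S \<inter> convex hull S') face_of (convex hull S)"
  unfolding face_of_def
proof (intro conjI ballI impI)
  show "convex (convex hull S \<inter> convex hull S')"
    by (simp add: convex_Int)
  fix a b x
  assume ab: "a \<in> convex hull S" "b \<in> convex hull S"
    and x: "x \<in> convex hull S \<inter> convex hull S'" "x \<in> open_segment a b"
  obtain \<alpha> where \<alpha>: "\<forall>v. 0 \<le> \<alpha> v" "{v. \<alpha> v \<noteq> 0} \<subseteq> S" "sum \<alpha> V = 1" "(\<Sum>v\<in>V. \<alpha> v *\<^sub>R v) = a"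
    using ab(1) convex_hull_weights[OF V(1,2)] by blast
  obtain \<beta> where \<beta>: "\<forall>v. 0 \<le> \<beta> v" "{v. \<beta> v \<noteq> 0} \<subseteq> S" "sum \<beta> V = 1" "(\<Sum>v\<in>V. \<beta> v *\<^sub>R v) = b"
    using ab(2) convex_hull_weights[OF V(1,2)] by blast
  obtain \<gamma> where \<gamma>: "\<forall>v. 0 \<le> \<gamma> v" "{v. \<gamma> v \<noteq> 0} \<subseteq> S'" "sum \<gamma> V = 1" "(\<Sum>v\<in>V. \<gamma> v *\<^sub>R v) = x"
    using x(1) convex_hull_weights[OF V(1,3)] by blast
  obtain t where t: "0 < t" "t < 1" "x = (1 - t) *\<^sub>R a + t *\<^sub>R b"
    using x(2) by (auto simp: in_segment)
  define c where "c v = (1 - t) * \<alpha> v + t * \<beta> v" for v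
  have "\<gamma> = c"
  proof (rule unique_weightsD[OF uniq])
    show "weighting K \<gamma>" using \<gamma> K by (auto simp: weighting_def)
    have "{v. c v \<noteq> 0} \<subseteq> S" using \<alpha>(2) \<beta>(2) by (force simp: c_def subset_iff)
    then show "weighting K c" using \<alpha>(1) \<beta>(1) t K by (auto simp: weighting_def c_def)
    show "sum \<gamma> V = sum c V"
      using \<alpha>(3) \<beta>(3) \<gamma>(3) by (simp add: c_def sum.distrib sum_distrib_left[symmetric])
    have "(\<Sum>v\<in>V. c v *\<^sub>R v) = (1 - t) *\<^sub>R (\<Sum>v\<in>V. \<alpha> v *\<^sub>R v) + t *\<^sub>R (\<Sum>v\<in>V. \<beta> v *\<^sub>R v)"
      by (simp add: c_def scaleR_add_left sum.distrib scaleR_right.sum)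
    then show "(\<Sum>v\<in>V. \<gamma> v *\<^sub>R v) = (\<Sum>v\<in>V. c v *\<^sub>R v)"
      using \<alpha>(4) \<beta>(4) \<gamma>(4) t(3) by simp
  qed
  then have zero: "\<alpha> v = 0 \<and> \<beta> v = 0" if "\<gamma> v = 0" for v
  proof -
    have "(1 - t) * \<alpha> v + t * \<beta> v = 0" using that \<open>\<gamma> = c\<close> c_def by simp
    moreover have "0 \<le> (1 - t) * \<alpha> v" "0 \<le> t * \<beta> v" using \<alpha>(1) \<beta>(1) t by auto
    ultimately have "(1 - t) * \<alpha> v = 0" "t * \<beta> v = 0" by linarith+
    then show ?thesis using t by simp
  qed
  then have "{v. \<alpha> v \<noteq> 0} \<subseteq> S'" "{v. \<beta> v \<noteq> 0} \<subseteq> S'" using \<gamma>(2) by blast+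
  then have "a \<in> convex hull S'" "b \<in> convex hull S'"
    using \<alpha> \<beta> convex_hull_weights[OF V(1,3)] by blast+
  with ab show "a \<in> convex hull S \<inter> convex hull S'" "b \<in> convex hull S \<inter> convex hull S'"
    by auto
qed auto

lemma vertex_triangulationI:
  assumes V: "finite V" "V \<subseteq> vertices P" and "convex P"
    and T: "\<And>S. S \<in> T \<Longrightarrow> S \<subseteq> V" "\<And>S. S \<in> T \<Longrightarrow> affine hull S = affine hull P"
    and cover: "\<And>x. x \<in> P \<Longrightarrow> \<exists>S\<in>T. x \<in> convex hull S"
    and uniq: "unique_weights V (faces T)"
  shows "vertex_triangulation P T"
proof -
  have VP: "V \<subseteq> P" using V(2) by (auto simp: vertices_def extreme_point_of_def)
  have Pow: "Pow S \<subseteq> faces T" if "S \<in> T" for S using that by (auto simp: faces_def)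
  have hull: "convex hull S \<subseteq> P" if "S \<in> T" for S
  proof -
    have "S \<subseteq> P" using T(1)[OF that] VP by blast
    then show ?thesis using \<open>convex P\<close> by (simp add: hull_minimal)
  qed
  have simplex: "S \<subseteq> vertices P \<and> finite S \<and> \<not> affine_dependent S \<and> affine hull S = affine hull P"
    if "S \<in> T" for S
    using unique_weights_affine_independent[OF V(1) T(1)[OF that] Pow[OF that] uniq]
      T(1)[OF that] T(2)[OF that] V finite_subset by auto
  have face: "(convex hull S \<inter> convex hull S') face_of (convex hull S)"
    if "S \<in> T" "S' \<in> T" for S S'
    using that by (intro unique_weights_hull_Int_face[OF V(1) T(1) T(1) Pow Pow uniq])
  have "(convex hull S \<inter> convex hull S') face_of (convex hull S')"
    if "S \<in> T" "S' \<in> T" for S S'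
    using face[OF that(2,1)] by (simp only: Int_commute)
  moreover have "(\<Union>S\<in>T. convex hull S) = P"
    using hull cover by (intro equalityI UN_least subsetI) auto
  ultimately show ?thesis
    unfolding vertex_triangulation_def using simplex face by simp
qed

text \<open>All simplices have the same affine hull, so an extra vertex of \<open>S'\<close> would
  be affinely dependent on \<open>S\<close>.\<close>

lemma vertex_triangulation_maximal:
  assumes "vertex_triangulation P T" "S \<in> T" "S' \<in> T" "S \<subseteq> S'"
  shows "S = S'"
proof (rule ccontr)
  assume "S \<noteq> S'"
  then obtain s where s: "s \<in> S'" "s \<notin> S" using assms by blast
  have "affine hull S = affine hull S'" and ind: "\<not> affine_dependent S'"
    using assms unfolding vertex_triangulation_def by auto
  then have "s \<in> affine hull S" using s by (simp add: hull_inc)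
  then have "s \<in> affine hull (S' - {s})"
    using assms(4) s hull_mono[of S "S' - {s}"] by blast
  with ind s show False unfolding affine_dependent_def by blast
qed

text \<open>Flips are defined on complexes of faces but counted as sets of maximal simplices; this
  lets a triangulation be identified by its faces.\<close>

lemma vertex_triangulation_faces_inject:
  assumes "vertex_triangulation P T" "vertex_triangulation P T'" "faces T = faces T'"
  shows "T = T'"
proof -
  have "T1 \<subseteq> T2" if "vertex_triangulation P T1" "vertex_triangulation P T2" "faces T1 = faces T2"
    for T1 T2 :: "'a set set"
  proof
    fix S assume S: "S \<in> T1"
    then have "S \<in> faces T2" using that(3) by (auto simp: faces_def)
    then obtain S' where S': "S' \<in> T2" "S \<subseteq> S'" by (auto simp: faces_def)
    then have "S' \<in> faces T1" using that(3) by (auto simp: faces_def)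
    then obtain S'' where "S'' \<in> T1" "S' \<subseteq> S''" by (auto simp: faces_def)
    then have "S = S''" using vertex_triangulation_maximal[OF that(1) S] S' by blast
    then show "S \<in> T2" using S' \<open>S' \<subseteq> S''\<close> by auto
  qed
  then show ?thesis using assms by (metis subset_antisym)
qed

section \<open>Coordinates of indicator vectors\<close>

lemma lookup_scaleR_real:
  fixes x :: "'a \<Rightarrow>\<^sub>0 real"
  shows "Poly_Mapping.lookup (c *\<^sub>R x) i = c * Poly_Mapping.lookup x i"
proof -
  have "finite {i. c * Poly_Mapping.lookup x i \<noteq> 0}"
    by (rule finite_subset[OF _ finite_keys[of x]]) (auto simp: in_keys_iff)
  then show ?thesis
    by (simp add: scaleR_poly_mapping_def lookup_Abs_poly_mapping)
qed

lemma lookup_indicator_vector: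
  assumes "finite F"
  shows "Poly_Mapping.lookup (indicator_vector F) i = (if i \<in> F then 1 else 0)"
  using assms by (simp add: indicator_vector_def lookup_sum lookup_single when_def)

lemma keys_indicator_vector: "finite F \<Longrightarrow> Poly_Mapping.keys (indicator_vector F) = F"
  by (auto simp: in_keys_iff lookup_indicator_vector split: if_splits)

section \<open>The canonical triangulation\<close>

text \<open>The support of the indicator vector of a filter is the filter itself, so comparability
  of filters can be expressed on vertices.\<close>

abbreviation comparable :: "('a \<Rightarrow>\<^sub>0 real) \<Rightarrow> ('a \<Rightarrow>\<^sub>0 real) \<Rightarrow> bool" where
  "comparable x y \<equiv> Poly_Mapping.keys x \<subseteq> Poly_Mapping.keys y \<or> Poly_Mapping.keys y \<subseteq> Poly_Mapping.keys x"

lemma finite_obtains_max: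
  fixes f :: "'b \<Rightarrow> nat"
  assumes "finite D" "D \<noteq> {}"
  obtains x where "x \<in> D" "\<And>y. y \<in> D \<Longrightarrow> f y \<le> f x"
proof -
  obtain x where x: "x \<in> D" "Max (f ` D) = f x"
    by (rule obtains_MAX[OF assms])
  have "f y \<le> f x" if "y \<in> D" for y
    unfolding x(2)[symmetric] using assms that by simp
  with x(1) show thesis by (rule that)
qed

locale finite_poset =
  fixes A :: "'a set" and r :: "'a rel"
  assumes finite_A: "finite A" and antisym_r: "antisym r" and trans_r: "trans r"
begin

definition V :: "('a \<Rightarrow>\<^sub>0 real) set" where
  "V = indicator_vector ` order_filters A r"

definition chains :: "('a \<Rightarrow>\<^sub>0 real) set set" where
  "chains = {S. S \<subseteq> V \<and> (\<forall>x\<in>S. \<forall>y\<in>S. comparable x y)}"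

abbreviation "P \<equiv> order_polytope A r"
abbreviation "T \<equiv> canonical_triangulation A r"

lemma finite_filter: "F \<in> order_filters A r \<Longrightarrow> finite F"
  using finite_A finite_subset by (auto simp: order_filters_def)

lemma empty_filter: "{} \<in> order_filters A r" and full_filter: "A \<in> order_filters A r"
  by (auto simp: order_filters_def)

lemma keys_V: "v \<in> V \<Longrightarrow> Poly_Mapping.keys v \<in> order_filters A r"
  by (auto simp: V_def keys_indicator_vector finite_filter)

lemma indicator_keys: "v \<in> V \<Longrightarrow> indicator_vector (Poly_Mapping.keys v) = v"
  by (auto simp: V_def keys_indicator_vector finite_filter)

lemma keys_inject: "v \<in> V \<Longrightarrow> u \<in> V \<Longrightarrow> Poly_Mapping.keys v = Poly_Mapping.keys u \<Longrightarrow> v = u"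
  using indicator_keys by metis

lemma lookup_V: "v \<in> V \<Longrightarrow> Poly_Mapping.lookup v i = (if i \<in> Poly_Mapping.keys v then 1 else 0)"
  using lookup_indicator_vector[of "Poly_Mapping.keys v" i] indicator_keys by simp

lemma indicator_in_V: "F \<in> order_filters A r \<Longrightarrow> indicator_vector F \<in> V"
  by (simp add: V_def)

lemma finite_V: "finite V"
proof -
  have "order_filters A r \<subseteq> Pow A" by (auto simp: order_filters_def)
  then show ?thesis unfolding V_def using finite_A finite_subset by blast
qed

lemma lookup_P_zero: "x \<in> P \<Longrightarrow> i \<notin> A \<Longrightarrow> Poly_Mapping.lookup x i = 0"
  unfolding order_polytope_def by (auto simp: in_keys_iff subset_iff)

lemma V_subset_P: "V \<subseteq> P"
proof
  fix v assume v: "v \<in> V"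
  then have "Poly_Mapping.keys v \<in> order_filters A r" by (rule keys_V)
  then show "v \<in> P"
    by (auto simp: order_polytope_def order_filters_def lookup_V[OF v])
qed

lemma convex_P: "convex P"
proof (rule convexI)
  fix x y :: "'a \<Rightarrow>\<^sub>0 real" and s t :: real
  assume xy: "x \<in> P" "y \<in> P" and st: "0 \<le> s" "0 \<le> t" "s + t = 1"
  have l: "Poly_Mapping.lookup (s *\<^sub>R x + t *\<^sub>R y) i
      = s * Poly_Mapping.lookup x i + t * Poly_Mapping.lookup y i" for i
    by (simp add: lookup_add lookup_scaleR_real)
  have "Poly_Mapping.lookup (s *\<^sub>R x + t *\<^sub>R y) i = 0" if "i \<notin> A" for i
    using xy that by (simp add: l lookup_P_zero)
  then have "Poly_Mapping.keys (s *\<^sub>R x + t *\<^sub>R y) \<subseteq> A"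
    by (auto simp: in_keys_iff)
  moreover have "s * a + t * b \<le> 1" if "a \<le> 1" "b \<le> 1" for a b
    using that st by (intro convex_bound_le)
  moreover have "s * a + t * b \<le> s * a' + t * b'" if "a \<le> a'" "b \<le> b'" for a b a' b'
    using that st by (intro add_mono mult_left_mono)
  ultimately show "s *\<^sub>R x + t *\<^sub>R y \<in> P"
    using xy st(1,2) unfolding order_polytope_def mem_Collect_eq l by simp
qed

text \<open>All coordinates of \<open>v\<close> are 0 or 1, the ends of the interval that contains
  the coordinates of \<open>a\<close> and \<open>b\<close>; a proper convex combination reaches an
  end only if both do.\<close>

lemma V_subset_vertices: "V \<subseteq> vertices P"
proof
  fix v assume v: "v \<in> V"
  have "v \<notin> open_segment a b" if "a \<in> P" "b \<in> P" for a b
  proof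
    assume "v \<in> open_segment a b"
    then obtain t where t: "0 < t" "t < 1" "v = (1 - t) *\<^sub>R a + t *\<^sub>R b" and "a \<noteq> b"
      by (auto simp: in_segment)
    have "Poly_Mapping.lookup a i = Poly_Mapping.lookup b i" for i
    proof (cases "i \<in> A")
      case True
      define x y where "x = Poly_Mapping.lookup a i" and "y = Poly_Mapping.lookup b i"
      have xy: "0 \<le> x" "x \<le> 1" "0 \<le> y" "y \<le> 1"
        using that True by (auto simp: order_polytope_def x_def y_def)
      have eq: "Poly_Mapping.lookup v i = (1 - t) * x + t * y"
        unfolding t(3) x_def y_def by (simp add: lookup_add lookup_scaleR_real)
      show ?thesis
      proof (cases "i \<in> Poly_Mapping.keys v")
        case True
        then have "(1 - t) * (1 - x) + t * (1 - y) = 0"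
          using eq lookup_V[OF v, of i] by (simp add: algebra_simps)
        moreover have "0 \<le> (1 - t) * (1 - x)" "0 \<le> t * (1 - y)" using t xy by auto
        ultimately have "(1 - t) * (1 - x) = 0" "t * (1 - y) = 0" by linarith+
        then show ?thesis using t by (simp add: x_def y_def)
      next
        case False
        then have "(1 - t) * x + t * y = 0"
          using eq lookup_V[OF v, of i] by (simp add: algebra_simps)
        moreover have "0 \<le> (1 - t) * x" "0 \<le> t * y" using t xy by auto
        ultimately have "(1 - t) * x = 0" "t * y = 0" by linarith+
        then show ?thesis using t by (simp add: x_def y_def)
      qed
    next
      case False
      then show ?thesis using that by (simp add: lookup_P_zero)
    qed
    with \<open>a \<noteq> b\<close> show False by (simp add: poly_mapping_eqI)
  qed
  then show "v \<in> vertices P"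
    using v V_subset_P by (auto simp: vertices_def extreme_point_of_def)
qed

lemma lookup_weighted_sum:
  "Poly_Mapping.lookup (\<Sum>v\<in>V. c v *\<^sub>R v) i = (\<Sum>v\<in>{v\<in>V. i \<in> Poly_Mapping.keys v}. c v)"
proof -
  have "Poly_Mapping.lookup (\<Sum>v\<in>V. c v *\<^sub>R v) i = (\<Sum>v\<in>V. if i \<in> Poly_Mapping.keys v then c v else 0)"
    by (auto simp: lookup_sum lookup_scaleR_real lookup_V intro!: sum.cong)
  then show ?thesis using finite_V by (simp add: sum.inter_filter)
qed

lemma chains_comparable: "S \<in> chains \<Longrightarrow> x \<in> S \<Longrightarrow> y \<in> S \<Longrightarrow> comparable x y"
  unfolding chains_def by simp

lemma chains_subset: "S \<in> chains \<Longrightarrow> S' \<subseteq> S \<Longrightarrow> S' \<in> chains"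
  unfolding chains_def by blast

text \<open>A filter of the support that contains \<open>j\<close> is comparable with
  \<open>f\<close> and not inside it, so it contains \<open>f\<close> and hence \<open>i\<close>.
  Coordinate \<open>i\<close> thus collects everything that coordinate \<open>j\<close> does, and
  \<open>c f\<close> in addition.\<close>

lemma weighting_chains_strict:
  assumes c: "weighting chains c" and f: "c f \<noteq> 0" "i \<in> Poly_Mapping.keys f" "j \<notin> Poly_Mapping.keys f"
  shows "Poly_Mapping.lookup (\<Sum>v\<in>V. c v *\<^sub>R v) j < Poly_Mapping.lookup (\<Sum>v\<in>V. c v *\<^sub>R v) i"
proof -
  have ch: "{v. c v \<noteq> 0} \<in> chains" and nn: "\<And>v. 0 \<le> c v" using c by (auto simp: weighting_def)
  have fV: "f \<in> V" using ch f by (auto simp: chains_def)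
  have j: "Poly_Mapping.lookup (\<Sum>v\<in>V. c v *\<^sub>R v) j
      = (\<Sum>v\<in>{v\<in>V. i \<in> Poly_Mapping.keys v \<and> j \<in> Poly_Mapping.keys v}. c v)"
    unfolding lookup_weighted_sum
  proof (rule sum.mono_neutral_right)
    show "\<forall>v\<in>{v \<in> V. j \<in> Poly_Mapping.keys v} - {v \<in> V. i \<in> Poly_Mapping.keys v \<and> j \<in> Poly_Mapping.keys v}. c v = 0"
      using f chains_comparable[OF ch, of f] by fastforce
  qed (use finite_V in auto)
  have "(\<Sum>v\<in>{v\<in>V. i \<in> Poly_Mapping.keys v \<and> j \<in> Poly_Mapping.keys v}. c v) + c f
      = (\<Sum>v\<in>insert f {v\<in>V. i \<in> Poly_Mapping.keys v \<and> j \<in> Poly_Mapping.keys v}. c v)"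
    using finite_V f by simp
  also have "\<dots> \<le> (\<Sum>v\<in>{v\<in>V. i \<in> Poly_Mapping.keys v}. c v)"
    using finite_V nn fV f by (intro sum_mono2) auto
  also have "\<dots> = Poly_Mapping.lookup (\<Sum>v\<in>V. c v *\<^sub>R v) i"
    by (simp add: lookup_weighted_sum)
  finally show ?thesis using j f nn[of f] by simp
qed

text \<open>
  Two chains carrying weights with the same sum of vectors are nested in a common chain: for
  \<open>i\<close> in \<open>f\<close> but not in \<open>g\<close>, and \<open>j\<close> in \<open>g\<close> but not in \<open>f\<close>, the coordinates at \<open>i\<close> and \<open>j\<close> would
  have to be strictly ordered both ways.
\<close>
lemma unique_weights_chains: "unique_weights V chains"
  unfolding unique_weights_def
proof (intro allI impI, elim conjE)
  fix c d
  assume c: "weighting chains c" and d: "weighting chains d" and total: "sum c V = sum d V"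
    and eq: "(\<Sum>v\<in>V. c v *\<^sub>R v) = (\<Sum>v\<in>V. d v *\<^sub>R v)"
  define C where "C = {v. c v \<noteq> 0} \<union> {v. d v \<noteq> 0}"
  have CV: "C \<subseteq> V" using c d by (auto simp: C_def weighting_def chains_def)
  have mixed: "comparable f g" if "c f \<noteq> 0" "d g \<noteq> 0" for f g
  proof (rule ccontr)
    assume "\<not> comparable f g"
    then obtain i j where ij: "i \<in> Poly_Mapping.keys f" "i \<notin> Poly_Mapping.keys g"
      "j \<in> Poly_Mapping.keys g" "j \<notin> Poly_Mapping.keys f" by blast
    show False
      using weighting_chains_strict[OF c that(1) ij(1,4)] weighting_chains_strict[OF d that(2) ij(3,2)] eq
      by simp
  qed
  have chain: "comparable f g" if "f \<in> C" "g \<in> C" for f g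
  proof -
    have "comparable f g" if "c f \<noteq> 0" "c g \<noteq> 0"
      using chains_comparable[of "{v. c v \<noteq> 0}" f g] c that by (simp add: weighting_def)
    moreover have "comparable f g" if "d f \<noteq> 0" "d g \<noteq> 0"
      using chains_comparable[of "{v. d v \<noteq> 0}" f g] d that by (simp add: weighting_def)
    ultimately show ?thesis
      using that mixed[of f g] mixed[of g f] unfolding C_def Un_iff mem_Collect_eq by argo
  qed
  \<comment> \<open>The difference of the weights lives on the single chain \<open>C\<close> and all
    its coordinate sums vanish. It is eliminated from the largest filter downwards.\<close>
  define e where "e v = c v - d v" for v
  have supp: "v \<in> C" if "e v \<noteq> 0" for v using that by (auto simp: e_def C_def)
  have coord: "(\<Sum>v\<in>{v\<in>V. i \<in> Poly_Mapping.keys v}. e v) = 0" for i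
    unfolding e_def sum_subtractf lookup_weighted_sum[symmetric] using eq by simp
  have nonempty: "e f = 0" if "Poly_Mapping.keys f \<noteq> {}" for f
  proof (rule ccontr)
    define D where "D = {v. e v \<noteq> 0 \<and> Poly_Mapping.keys v \<noteq> {}}"
    assume "e f \<noteq> 0"
    then have "f \<in> D" using that by (simp add: D_def)
    have "D \<subseteq> C" using supp by (auto simp: D_def)
    then have finD: "finite D" using finite_subset[OF _ finite_V, of D] CV by simp
    then obtain g where g: "g \<in> D" and max: "\<And>h. h \<in> D \<Longrightarrow> card (Poly_Mapping.keys h) \<le> card (Poly_Mapping.keys g)"
      using \<open>f \<in> D\<close> finite_obtains_max[of D "\<lambda>h. card (Poly_Mapping.keys h)"] by (metis empty_iff)
    define B where "B = D - {g}"
    have sub: "Poly_Mapping.keys h \<subset> Poly_Mapping.keys g" if "h \<in> B" for h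
    proof -
      have "Poly_Mapping.keys h \<noteq> Poly_Mapping.keys g"
        using keys_inject[of h g] that g \<open>D \<subseteq> C\<close> CV by (auto simp: B_def)
      moreover have "comparable h g" using chain that g \<open>D \<subseteq> C\<close> by (auto simp: B_def)
      moreover have "\<not> Poly_Mapping.keys g \<subset> Poly_Mapping.keys h"
        using max[of h] that psubset_card_mono[OF finite_keys[of h], of "Poly_Mapping.keys g"]
        by (auto simp: B_def)
      ultimately show ?thesis by blast
    qed
    \<comment> \<open>The other nonempty members of the support of \<open>e\<close> form a chain
      strictly inside \<open>g\<close>, so the largest of them misses some \<open>i\<close> in
      \<open>g\<close>, and then all do. The coordinate sum at \<open>i\<close> is therefore
      \<open>e g\<close> alone.\<close>
    have "\<exists>i\<in>Poly_Mapping.keys g. \<forall>h\<in>B. i \<notin> Poly_Mapping.keys h"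
    proof (cases "B = {}")
      case True
      moreover have "Poly_Mapping.keys g \<noteq> {}" using g unfolding D_def by blast
      ultimately show ?thesis by blast
    next
      case False
      have "finite B" using finD by (simp add: B_def)
      then obtain h where h: "h \<in> B" and hmax: "\<And>h'. h' \<in> B \<Longrightarrow> card (Poly_Mapping.keys h') \<le> card (Poly_Mapping.keys h)"
        using False finite_obtains_max[of B "\<lambda>h. card (Poly_Mapping.keys h)"] by metis
      have "Poly_Mapping.keys h' \<subseteq> Poly_Mapping.keys h" if "h' \<in> B" for h'
      proof -
        have "comparable h' h" using chain that h \<open>D \<subseteq> C\<close> by (auto simp: B_def)
        then show ?thesis
          using hmax[OF that] card_seteq[OF finite_keys[of h']] by blast
      qed
      then show ?thesis using sub[OF h] by blast
    qed
    then obtain i where i: "i \<in> Poly_Mapping.keys g" "\<forall>h\<in>B. i \<notin> Poly_Mapping.keys h" by blast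
    have "(\<Sum>v\<in>{v\<in>V. i \<in> Poly_Mapping.keys v}. e v) = (\<Sum>v\<in>{g}. e v)"
    proof (rule sum.mono_neutral_right)
      show "\<forall>v\<in>{v \<in> V. i \<in> Poly_Mapping.keys v} - {g}. e v = 0"
        using i by (auto simp: B_def D_def)
    qed (use finite_V i g \<open>D \<subseteq> C\<close> CV in auto)
    then show False using coord g by (auto simp: D_def)
  qed
  \<comment> \<open>The empty filter appears in no coordinate; its weight is fixed by the equal
    totals.\<close>
  have "0 \<in> V" using indicator_in_V[OF empty_filter] by (simp add: indicator_vector_def)
  have "sum e V = (\<Sum>v\<in>{0}. e v)"
    using nonempty finite_V \<open>0 \<in> V\<close> by (intro sum.mono_neutral_right) auto
  then have "e 0 = 0"
    using total by (simp add: e_def sum_subtractf)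
  then have "e v = 0" for v
    using nonempty[of v] by (cases "v = 0") auto
  then show "c = d" by (auto simp: e_def)
qed


text \<open>Greedy peeling: monotonicity makes the support \<open>F\<close> of \<open>x\<close> a
  filter, and subtracting the least positive coordinate \<open>a\<close> times its indicator vector
  keeps the coordinates nonnegative and monotone while the support loses an element. The last
  conjunct is carried through the induction because it places all later filters inside
  \<open>F\<close> and so makes them comparable with it. The bound \<open>m\<close> drops by
  \<open>a\<close> in each round, which controls the total weight.\<close>

lemma exists_weighting:
  assumes x: "Poly_Mapping.keys x \<subseteq> A" "\<And>i. 0 \<le> Poly_Mapping.lookup x i" "\<And>i. Poly_Mapping.lookup x i \<le> m"
    and mono: "\<And>i j. i \<in> A \<Longrightarrow> j \<in> A \<Longrightarrow> (i, j) \<in> r \<Longrightarrow> Poly_Mapping.lookup x i \<le> Poly_Mapping.lookup x j"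
    and "0 \<le> m"
  shows "\<exists>c. weighting chains c \<and> sum c V \<le> m \<and> (\<Sum>v\<in>V. c v *\<^sub>R v) = x \<and>
    (\<forall>v. c v \<noteq> 0 \<longrightarrow> Poly_Mapping.keys v \<subseteq> Poly_Mapping.keys x)"
  using assms
proof (induction "card (Poly_Mapping.keys x)" arbitrary: x m rule: less_induct)
  case less
  show ?case
  proof (cases "x = 0")
    case True
    then show ?thesis
      using less.prems(5) by (intro exI[of _ "\<lambda>_. 0"]) (auto simp: weighting_def chains_def)
  next
    case False
    define F where "F = Poly_Mapping.keys x"
    have F: "finite F" "F \<noteq> {}" using False by (auto simp: F_def)
    define a where "a = Min (Poly_Mapping.lookup x ` F)"
    have "a \<in> Poly_Mapping.lookup x ` F" unfolding a_def by (rule Min_in) (use F in auto)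
    then obtain i0 where i0: "i0 \<in> F" "a = Poly_Mapping.lookup x i0" by blast
    have a_le: "a \<le> Poly_Mapping.lookup x i" if "i \<in> F" for i
      using F that by (simp add: a_def)
    have a_pos: "0 < a"
      using i0 less.prems(2)[of i0] by (simp add: F_def in_keys_iff)
    have filter: "F \<in> order_filters A r"
      unfolding order_filters_def
    proof (intro CollectI conjI ballI impI)
      show "F \<subseteq> A" using less.prems(1) by (simp add: F_def)
      fix i j assume "i \<in> F" "j \<in> A" "(i, j) \<in> r"
      then have "a \<le> Poly_Mapping.lookup x j"
        using a_le[of i] less.prems(4)[of i j] \<open>F \<subseteq> A\<close> by force
      then show "j \<in> F" using a_pos by (simp add: F_def in_keys_iff)
    qed
    define f where "f = (indicator_vector F :: 'a \<Rightarrow>\<^sub>0 real)"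
    have f: "f \<in> V" "Poly_Mapping.keys f = F"
      using indicator_in_V[OF filter] keys_indicator_vector[OF F(1)] by (auto simp: f_def)
    define y where "y = x - a *\<^sub>R f"
    have y: "Poly_Mapping.lookup y i = (if i \<in> F then Poly_Mapping.lookup x i - a else 0)" for i
      using lookup_indicator_vector[OF F(1), of i]
      by (auto simp: y_def f_def lookup_minus lookup_scaleR_real F_def in_keys_iff)
    have sub: "Poly_Mapping.keys y \<subseteq> F - {i0}"
      using i0 by (auto simp: in_keys_iff y split: if_splits)
    have "card (Poly_Mapping.keys y) < card F"
      using psubset_card_mono[OF F(1), of "Poly_Mapping.keys y"] sub i0 by blast
    moreover have "F \<subseteq> A" using filter by (auto simp: order_filters_def)
    moreover have "a \<le> m" using i0 less.prems(3) by simp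
    ultimately have "\<exists>c. weighting chains c \<and> sum c V \<le> m - a \<and> (\<Sum>v\<in>V. c v *\<^sub>R v) = y \<and>
        (\<forall>v. c v \<noteq> 0 \<longrightarrow> Poly_Mapping.keys v \<subseteq> Poly_Mapping.keys y)"
    proof (intro less.hyps)
      fix i j assume ij: "i \<in> A" "j \<in> A" "(i, j) \<in> r"
      then have "j \<in> F" if "i \<in> F" using filter that by (auto simp: order_filters_def)
      then show "Poly_Mapping.lookup y i \<le> Poly_Mapping.lookup y j"
        using less.prems(4)[OF ij] a_le by (auto simp: y)
    qed (use sub less.prems a_le in \<open>auto simp: y F_def\<close>)
    then obtain c where c: "weighting chains c" "sum c V \<le> m - a" "(\<Sum>v\<in>V. c v *\<^sub>R v) = y"
        "\<And>v. c v \<noteq> 0 \<Longrightarrow> Poly_Mapping.keys v \<subseteq> F - {i0}"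
      using sub by blast
    \<comment> \<open>Only \<open>f\<close> still contains \<open>i0\<close>, so it has not been
      used yet and its weight can be set to \<open>a\<close>.\<close>
    have cf: "c f = 0" using c(4)[of f] f i0 by auto
    define d where "d = c(f := a)"
    have supp: "{v. d v \<noteq> 0} = insert f {v. c v \<noteq> 0}" using a_pos by (auto simp: d_def)
    have "insert f {v. c v \<noteq> 0} \<in> chains"
      using c(1,4) f by (auto simp: weighting_def chains_def)
    then have "weighting chains d"
      using c(1) a_pos supp by (auto simp: weighting_def d_def)
    moreover have d_eq: "d v = c v + (if v = f then a else 0)" for v
      using cf by (simp add: d_def)
    have "sum d V = sum c V + a"
      unfolding d_eq sum.distrib using f finite_V by simp
    moreover have "(\<Sum>v\<in>V. d v *\<^sub>R v) = (\<Sum>v\<in>V. c v *\<^sub>R v) + (\<Sum>v\<in>V. (if v = f then a else 0) *\<^sub>R v)"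
      unfolding d_eq scaleR_add_left sum.distrib by simp
    moreover have "(\<Sum>v\<in>V. (if v = f then a else 0) *\<^sub>R v) = (\<Sum>v\<in>V. if v = f then a *\<^sub>R f else 0)"
      by (intro sum.cong) auto
    then have "(\<Sum>v\<in>V. (if v = f then a else 0) *\<^sub>R v) = a *\<^sub>R f"
      using f finite_V by simp
    moreover have "Poly_Mapping.keys v \<subseteq> Poly_Mapping.keys x" if "d v \<noteq> 0" for v
      using that c(4)[of v] f by (auto simp: d_def F_def split: if_splits)
    ultimately show ?thesis
      using c(2,3) by (intro exI[of _ d]) (auto simp: y_def)
  qed
qed

lemma exists_chain_weighting:
  assumes "x \<in> P"
  shows "\<exists>c. weighting chains c \<and> sum c V = 1 \<and> (\<Sum>v\<in>V. c v *\<^sub>R v) = x"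
proof -
  have "0 \<le> Poly_Mapping.lookup x i" "Poly_Mapping.lookup x i \<le> 1" for i
    using assms lookup_P_zero[OF assms, of i] by (cases "i \<in> A"; auto simp: order_polytope_def)+
  moreover have "Poly_Mapping.lookup x i \<le> Poly_Mapping.lookup x j" if "i \<in> A" "j \<in> A" "(i, j) \<in> r" for i j
    using assms that by (cases "i = j") (auto simp: order_polytope_def)
  ultimately obtain c where c: "weighting chains c" "sum c V \<le> 1" "(\<Sum>v\<in>V. c v *\<^sub>R v) = x"
    using exists_weighting[of x 1] assms by (auto simp: order_polytope_def)
  define e where "e = (indicator_vector {} :: 'a \<Rightarrow>\<^sub>0 real)"
  have e: "e \<in> V" "e = 0" "Poly_Mapping.keys e = {}"
    using indicator_in_V[OF empty_filter] by (auto simp: e_def indicator_vector_def)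
  \<comment> \<open>The missing weight goes to the empty filter, which is comparable with every
    filter and, being the zero vector, leaves the vector sum unchanged.\<close>
  define d where "d v = c v + (if v = e then 1 - sum c V else 0)" for v
  have "{v. d v \<noteq> 0} \<subseteq> insert e {v. c v \<noteq> 0}" by (auto simp: d_def)
  moreover have "insert e {v. c v \<noteq> 0} \<in> chains"
    using c(1) e by (auto simp: weighting_def chains_def)
  ultimately have "weighting chains d"
    using c(1,2) chains_subset by (auto simp: weighting_def d_def)
  moreover have "sum d V = 1"
    unfolding d_def sum.distrib using e finite_V by simp
  moreover have "(\<Sum>v\<in>V. d v *\<^sub>R v) = x"
    unfolding c(3)[symmetric] using e(2) by (intro sum.cong) (auto simp: d_def)
  ultimately show ?thesis by blast
qed

section \<open>Maximal chains of filters as full-dimensional simplices\<close>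

lemma canonical_subset_V: "S \<in> T \<Longrightarrow> S \<subseteq> V"
  unfolding canonical_triangulation_def V_def
  by (auto simp: subset.maxchain_def subset.chain_def)

lemma canonical_in_chains:
  assumes "S \<in> T"
  shows "S \<in> chains"
proof -
  obtain C where C: "subset.chain (order_filters A r) C" "S = indicator_vector ` C"
    using assms by (auto simp: canonical_triangulation_def subset.maxchain_def)
  have keys: "Poly_Mapping.keys (indicator_vector F :: 'a \<Rightarrow>\<^sub>0 real) = F" if "F \<in> C" for F
    using C(1) that finite_filter keys_indicator_vector unfolding subset_chain_def by blast
  have "comparable (indicator_vector F) (indicator_vector G :: 'a \<Rightarrow>\<^sub>0 real)" if "F \<in> C" "G \<in> C" for F G
    unfolding keys[OF that(1)] keys[OF that(2)] using C(1) that by (auto simp: subset_chain_def)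
  then show ?thesis
    using C(2) canonical_subset_V[OF assms] by (simp add: chains_def)
qed

lemma canonical_maximal:
  assumes "S \<in> T" "v \<in> V" "\<And>u. u \<in> S \<Longrightarrow> comparable v u"
  shows "v \<in> S"
proof -
  obtain C where C: "subset.maxchain (order_filters A r) C" "S = indicator_vector ` C"
    using assms(1) by (auto simp: canonical_triangulation_def)
  then have ch: "subset.chain (order_filters A r) C" by (simp add: subset.maxchain_def)
  let ?C = "insert (Poly_Mapping.keys v) C"
  have sub: "C \<subseteq> order_filters A r" using ch by (auto simp: subset.chain_def)
  have "Poly_Mapping.keys v \<subseteq> F \<or> F \<subseteq> Poly_Mapping.keys v" if "F \<in> C" for F
  proof -
    have "Poly_Mapping.keys (indicator_vector F :: 'a \<Rightarrow>\<^sub>0 real) = F"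
      using sub that finite_filter keys_indicator_vector by blast
    then show ?thesis using assms(3)[of "indicator_vector F"] C(2) that by auto
  qed
  then have "subset.chain (order_filters A r) ?C"
    using ch keys_V[OF assms(2)] unfolding subset_chain_insert by auto
  then have "Poly_Mapping.keys v \<in> C"
    using C(1) unfolding subset.maxchain_def by blast
  then show ?thesis using indicator_keys[OF assms(2)] C(2) by force
qed

text \<open>Finiteness lets every chain of filters extend to a maximal one, so being a face becomes
  a condition on pairs of vertices.\<close>

lemma faces_canonical: "faces T = chains"
proof
  show "faces T \<subseteq> chains"
    using canonical_in_chains chains_subset by (auto simp: faces_def)
  show "chains \<subseteq> faces T"
  proof
    fix S assume S: "S \<in> chains"
    let ?F = "{C. subset.chain (order_filters A r) C}"
    have "order_filters A r \<subseteq> Pow A" by (auto simp: order_filters_def)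
    then have "finite (order_filters A r)" using finite_A finite_subset by blast
    moreover have "?F \<subseteq> Pow (order_filters A r)" by (auto simp: subset.chain_def)
    ultimately have "finite ?F" by (meson finite_Pow_iff finite_subset)
    moreover have "Poly_Mapping.keys ` S \<in> ?F"
      using S keys_V by (force simp: subset.chain_def chains_def)
    ultimately obtain C where C: "C \<in> ?F" "Poly_Mapping.keys ` S \<subseteq> C" "\<forall>D\<in>?F. C \<subseteq> D \<longrightarrow> C = D"
      using finite_has_maximal2[of ?F "Poly_Mapping.keys ` S"] by meson
    then have "subset.maxchain (order_filters A r) C"
      by (auto simp: subset.maxchain_def)
    moreover have "S \<subseteq> indicator_vector ` C"
    proof
      fix v assume v: "v \<in> S"
      then have "v = indicator_vector (Poly_Mapping.keys v)"
        using S indicator_keys by (auto simp: chains_def)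
      then show "v \<in> indicator_vector ` C" using C(2) v by blast
    qed
    ultimately show "S \<in> faces T"
      unfolding faces_def canonical_triangulation_def by blast
  qed
qed

lemma affine_hull_eq_P:
  assumes "S \<subseteq> V" "P \<subseteq> affine hull S"
  shows "affine hull S = affine hull P"
proof
  show "affine hull S \<subseteq> affine hull P"
    using assms(1) V_subset_P by (intro hull_mono) auto
  show "affine hull P \<subseteq> affine hull S"
    using assms(2) by (simp add: hull_minimal)
qed

text \<open>A maximal element \<open>j\<close> of \<open>G - H\<close> works: whatever lies above
  \<open>j\<close> is in \<open>G\<close> because \<open>G\<close> is a filter, and then in
  \<open>H\<close> by maximality unless it is \<open>j\<close>.\<close>

lemma filter_extension:
  assumes H: "H \<in> order_filters A r" and G: "G \<in> order_filters A r" and "H \<subset> G"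
  obtains j where "j \<in> G - H" "insert j H \<in> order_filters A r"
proof -
  define m where "m = G - H"
  have "finite m" "m \<noteq> {}" using finite_filter[OF G] \<open>H \<subset> G\<close> by (auto simp: m_def)
  moreover have "asymp_on m (\<lambda>x y. (x, y) \<in> r \<and> x \<noteq> y)" "transp_on m (\<lambda>x y. (x, y) \<in> r \<and> x \<noteq> y)"
    using antisym_r trans_r by (auto simp: asymp_on_def transp_on_def antisym_def trans_def)
  ultimately obtain j where j: "j \<in> m" "\<And>x. x \<in> m \<Longrightarrow> x \<noteq> j \<Longrightarrow> (j, x) \<notin> r"
    using Finite_Set.bex_max_element[of m "\<lambda>x y. (x, y) \<in> r \<and> x \<noteq> y"] by blast
  have "insert j H \<in> order_filters A r"
    unfolding order_filters_def
  proof (intro CollectI conjI ballI impI)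
    show "insert j H \<subseteq> A" using H G j by (auto simp: order_filters_def m_def)
    fix x y assume xy: "x \<in> insert j H" "y \<in> A" "(x, y) \<in> r"
    show "y \<in> insert j H"
    proof (cases "x \<in> H")
      case True
      then show ?thesis using xy H by (auto simp: order_filters_def)
    next
      case False
      then have "y \<in> G" using xy j G by (auto simp: order_filters_def m_def)
      then show ?thesis using j(2)[of y] xy False by (auto simp: m_def)
    qed
  qed
  with j(1) show thesis using that by (simp add: m_def)
qed

text \<open>The zero vector is a vertex of \<open>S\<close>, so the affine hull is a linear span and
  it suffices to find every unit vector in it. The unit vector at \<open>i\<close> is the difference
  of the two consecutive members of the chain between which \<open>i\<close> enters.\<close>

lemma affine_hull_canonical:
  assumes S: "S \<in> T"
  shows "P \<subseteq> affine hull S"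
proof -
  have SV: "S \<subseteq> V" and ch: "S \<in> chains"
    using canonical_subset_V canonical_in_chains S by auto
  have finS: "finite S" using SV finite_V finite_subset by blast
  have in_S: "indicator_vector F \<in> S" if "F \<in> order_filters A r" "\<And>u. u \<in> S \<Longrightarrow> F \<subseteq> Poly_Mapping.keys u \<or> Poly_Mapping.keys u \<subseteq> F" for F
    using canonical_maximal[OF S indicator_in_V[OF that(1)]] that
      keys_indicator_vector[OF finite_filter[OF that(1)]] by auto
  have keysA: "Poly_Mapping.keys u \<subseteq> A" if "u \<in> S" for u
    using keys_V[of u] SV that by (auto simp: order_filters_def)
  have empty: "indicator_vector {} \<in> S" by (rule in_S[OF empty_filter]) auto
  have full: "indicator_vector A \<in> S" by (rule in_S[OF full_filter]) (use keysA in auto)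
  have "0 \<in> S" using empty by (simp add: indicator_vector_def)
  then have span: "affine hull S = span S" by (simp add: affine_hull_span_0 hull_inc)
  have single: "Poly_Mapping.single i 1 \<in> span S" if i: "i \<in> A" for i
  proof -
    \<comment> \<open>\<open>G\<close> will be the smallest member of the chain that contains
      \<open>i\<close>, and \<open>H\<close> the largest one that misses it.\<close>
    define U where "U = {u\<in>S. i \<in> Poly_Mapping.keys u}"
    define D where "D = {u\<in>S. i \<notin> Poly_Mapping.keys u}"
    define G where "G = (\<Inter>u\<in>U. Poly_Mapping.keys u)"
    define H where "H = (\<Union>u\<in>D. Poly_Mapping.keys u)"
    have U: "indicator_vector A \<in> U"
      using full i finite_A by (simp add: U_def keys_indicator_vector)
    have D: "indicator_vector {} \<in> D"
      using empty by (simp add: D_def indicator_vector_def)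
    have filters: "Poly_Mapping.keys u \<in> order_filters A r" if "u \<in> S" for u
      using keys_V SV that by auto
    have up: "y \<in> Poly_Mapping.keys u" if "u \<in> S" "x \<in> Poly_Mapping.keys u" "y \<in> A" "(x, y) \<in> r" for u x y
      using filters[OF that(1)] that(2-4) by (auto simp: order_filters_def)
    have "G \<subseteq> A" using keysA U by (auto simp: G_def U_def)
    then have Gf: "G \<in> order_filters A r"
      using up by (auto simp: order_filters_def G_def U_def)
    have "H \<subseteq> A" using keysA by (auto simp: H_def D_def)
    then have Hf: "H \<in> order_filters A r"
      using up by (auto simp: order_filters_def H_def D_def)
    have UD: "Poly_Mapping.keys d \<subseteq> Poly_Mapping.keys u" if "u \<in> U" "d \<in> D" for u d
      using chains_comparable[OF ch, of d u] that by (auto simp: U_def D_def)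
    have split: "u \<in> U \<or> u \<in> D" if "u \<in> S" for u using that by (auto simp: U_def D_def)
    have "i \<in> G" "i \<notin> H" "H \<subseteq> G" using UD by (auto simp: G_def H_def U_def D_def)
    then obtain j where j: "j \<in> G - H" and jH: "insert j H \<in> order_filters A r"
      using filter_extension[OF Hf Gf] by blast
    have between: "F \<subseteq> Poly_Mapping.keys u \<or> Poly_Mapping.keys u \<subseteq> F"
      if "u \<in> S" "H \<subseteq> F" "F \<subseteq> G" for F u
      using split[OF that(1)] that by (auto simp: G_def H_def)
    have "indicator_vector H \<in> S" "indicator_vector G \<in> S"
      using in_S Hf Gf between \<open>H \<subseteq> G\<close> by blast+
    moreover have "insert j H \<subseteq> G" using \<open>H \<subseteq> G\<close> j by auto
    then have jS: "indicator_vector (insert j H) \<in> S"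
      using in_S[OF jH] between by blast
    \<comment> \<open>\<open>insert j H\<close> fits between \<open>H\<close> and \<open>G\<close>,
      so maximality puts it into the chain. If \<open>j\<close> differs from \<open>i\<close>, it
      misses \<open>i\<close> and would lie inside \<open>H\<close>, which is absurd; otherwise it
      contains \<open>i\<close> and hence \<open>G\<close>.\<close>
    have "G = insert j H"
    proof (cases "i = j")
      case False
      have "Poly_Mapping.keys (indicator_vector (insert j H) :: 'a \<Rightarrow>\<^sub>0 real) = insert j H"
        using keys_indicator_vector finite_filter[OF jH] by blast
      moreover have "i \<notin> insert j H" using False \<open>i \<notin> H\<close> by simp
      ultimately have "indicator_vector (insert j H) \<in> D" using jS by (simp add: D_def)
      then have "insert j H \<subseteq> H"
        using \<open>Poly_Mapping.keys _ = insert j H\<close> by (auto simp: H_def)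
      then show ?thesis using j by auto
    next
      case True
      have "Poly_Mapping.keys (indicator_vector (insert j H) :: 'a \<Rightarrow>\<^sub>0 real) = insert j H"
        using keys_indicator_vector finite_filter[OF jH] by blast
      then have "indicator_vector (insert j H) \<in> U" using jS True by (simp add: U_def)
      then have "G \<subseteq> insert j H"
        using \<open>Poly_Mapping.keys _ = insert j H\<close> by (auto simp: G_def)
      then show ?thesis using \<open>insert j H \<subseteq> G\<close> by blast
    qed
    then have "i = j" "G = insert i H" using \<open>i \<in> G\<close> \<open>i \<notin> H\<close> by auto
    then have "indicator_vector G = Poly_Mapping.single i 1 + (indicator_vector H :: 'a \<Rightarrow>\<^sub>0 real)"
      using \<open>i \<notin> H\<close> finite_filter[OF Hf] by (simp add: indicator_vector_def)
    then have "Poly_Mapping.single i 1 = indicator_vector G - (indicator_vector H :: 'a \<Rightarrow>\<^sub>0 real)"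
      by simp
    then show ?thesis
      using calculation span_diff span_base by metis
  qed
  show ?thesis
  proof
    fix x assume x: "x \<in> P"
    have "x = (\<Sum>i\<in>A. Poly_Mapping.lookup x i *\<^sub>R Poly_Mapping.single i 1)"
    proof (rule poly_mapping_eqI)
      fix j
      have "(\<Sum>i\<in>A. Poly_Mapping.lookup x i * Poly_Mapping.lookup (Poly_Mapping.single i (1::real)) j)
          = (\<Sum>i\<in>A. if i = j then Poly_Mapping.lookup x i else 0)"
        by (intro sum.cong) (auto simp: lookup_single when_def)
      then show "Poly_Mapping.lookup x j = Poly_Mapping.lookup (\<Sum>i\<in>A. Poly_Mapping.lookup x i *\<^sub>R Poly_Mapping.single i 1) j"
        using finite_A lookup_P_zero[OF x, of j] by (simp add: lookup_sum lookup_scaleR_real)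
    qed
    also have "\<dots> \<in> span S"
      by (intro span_sum span_scale single)
    finally show "x \<in> affine hull S" by (simp add: span)
  qed
qed

end

section \<open>Flipping a parallelogram\<close>

context finite_poset
begin

text \<open>The pair is unordered so that exchanging \<open>a\<close> and \<open>b\<close> does not
  count a parallelogram twice.\<close>

definition squares :: "('a set \<times> 'a set) set" where
  "squares = {(M, {a, b}) | M a b. a \<noteq> b \<and> a \<notin> M \<and> b \<notin> M \<and> M \<in> order_filters A r \<and>
     insert a M \<in> order_filters A r \<and> insert b M \<in> order_filters A r}"

text \<open>For \<open>e = {a, b}\<close> the image of \<open>e\<close> is the pair of middle
  vertices. A maximal chain through bottom and top of the parallelogram gains both and loses either
  bottom or top; two chains that differ only in their middle vertex yield the same new
  simplices.\<close>

definition flipped :: "'a set \<Rightarrow> 'a set \<Rightarrow> ('a \<Rightarrow>\<^sub>0 real) set set" where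
  "flipped M e = {S \<in> T. \<not> {indicator_vector M, indicator_vector (M \<union> e)} \<subseteq> S} \<union>
     {(\<lambda>x. indicator_vector (insert x M)) ` e \<union> (S - {z}) | S z. S \<in> T \<and>
        {indicator_vector M, indicator_vector (M \<union> e)} \<subseteq> S \<and>
        z \<in> {indicator_vector M, indicator_vector (M \<union> e)}}"

lemma parallelogram:
  assumes "p \<in> V" "q \<in> V"
  shows "p + q = indicator_vector (Poly_Mapping.keys p \<inter> Poly_Mapping.keys q)
    + indicator_vector (Poly_Mapping.keys p \<union> Poly_Mapping.keys q)"
proof (rule poly_mapping_eqI)
  fix i
  show "Poly_Mapping.lookup (p + q) i = Poly_Mapping.lookup (indicator_vector (Poly_Mapping.keys p \<inter> Poly_Mapping.keys q)
    + indicator_vector (Poly_Mapping.keys p \<union> Poly_Mapping.keys q)) i"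
    using lookup_V[OF assms(1), of i] lookup_V[OF assms(2), of i]
    by (simp add: lookup_add lookup_indicator_vector del: lookup_not_eq_zero_eq_in_keys)
qed

lemma Int_filter: "F \<in> order_filters A r \<Longrightarrow> G \<in> order_filters A r \<Longrightarrow> F \<inter> G \<in> order_filters A r"
  and Un_filter: "F \<in> order_filters A r \<Longrightarrow> G \<in> order_filters A r \<Longrightarrow> F \<union> G \<in> order_filters A r"
  by (auto simp: order_filters_def)

lemma chains_affine_independent:
  assumes "S \<in> chains"
  shows "\<not> affine_dependent S"
proof (rule unique_weights_affine_independent[OF finite_V _ _ unique_weights_chains])
  show "S \<subseteq> V" using assms by (simp add: chains_def)
  show "Pow S \<subseteq> chains" using chains_subset[OF assms] by blast
qed

end

section \<open>One parallelogram of filters: bottom \<open>l\<close>, sides \<open>p\<close> and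
  \<open>q\<close>, top \<open>u\<close>\<close>

locale square = finite_poset +
  fixes M a b
  assumes ab: "a \<noteq> b" "a \<notin> M" "b \<notin> M"
    and M: "M \<in> order_filters A r" and aM: "insert a M \<in> order_filters A r"
    and bM: "insert b M \<in> order_filters A r"
begin

abbreviation "l \<equiv> indicator_vector M :: 'a \<Rightarrow>\<^sub>0 real"
abbreviation "p \<equiv> indicator_vector (insert a M) :: 'a \<Rightarrow>\<^sub>0 real"
abbreviation "q \<equiv> indicator_vector (insert b M) :: 'a \<Rightarrow>\<^sub>0 real"
abbreviation "u \<equiv> indicator_vector (insert a (insert b M)) :: 'a \<Rightarrow>\<^sub>0 real"

lemma abM: "insert a (insert b M) \<in> order_filters A r"
  using Un_filter[OF aM bM] by (simp add: insert_commute)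

lemma in_V: "l \<in> V" "p \<in> V" "q \<in> V" "u \<in> V"
  using M aM bM abM by (simp_all add: indicator_in_V)

lemma keys_simps [simp]:
  "Poly_Mapping.keys l = M" "Poly_Mapping.keys p = insert a M"
  "Poly_Mapping.keys q = insert b M" "Poly_Mapping.keys u = insert a (insert b M)"
  using M aM bM abM finite_filter by (simp_all add: keys_indicator_vector)

lemma distinct [simp]:
  "l \<noteq> p" "l \<noteq> q" "l \<noteq> u" "p \<noteq> q" "p \<noteq> u" "q \<noteq> u"
  "p \<noteq> l" "q \<noteq> l" "u \<noteq> l" "q \<noteq> p" "u \<noteq> p" "u \<noteq> q"
proof -
  have *: "x \<noteq> y" "y \<noteq> x" if "Poly_Mapping.keys x \<noteq> Poly_Mapping.keys y" for x y :: "'a \<Rightarrow>\<^sub>0 real"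
    using that by auto
  have "M \<noteq> insert a M" "M \<noteq> insert b M" "M \<noteq> insert a (insert b M)"
     "insert a M \<noteq> insert b M" "insert a M \<noteq> insert a (insert b M)" "insert b M \<noteq> insert a (insert b M)"
    using ab by (metis insert_iff)+
  then show "l \<noteq> p" "l \<noteq> q" "l \<noteq> u" "p \<noteq> q" "p \<noteq> u" "q \<noteq> u"
    "p \<noteq> l" "q \<noteq> l" "u \<noteq> l" "q \<noteq> p" "u \<noteq> p" "u \<noteq> q"
    using *[of l p] *[of l q] *[of l u] *[of p q] *[of p u] *[of q u] by simp_all
qed

lemma incomparable: "\<not> comparable p q"
  using ab by auto

lemma sum_eq: "p + q = l + u"
proof -
  have "insert a M \<inter> insert b M = M" "insert a M \<union> insert b M = insert a (insert b M)"
    using ab by auto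
  then show ?thesis using parallelogram[OF in_V(2,3)] by simp
qed

text \<open>Only four sets lie between the bottom and the top of the parallelogram, so nothing but
  \<open>p\<close> and \<open>q\<close> is strictly between them.\<close>

lemma comparable_cases:
  assumes "v \<in> V" "comparable v l" "comparable v u"
  shows "Poly_Mapping.keys v \<subseteq> M \<or> insert a (insert b M) \<subseteq> Poly_Mapping.keys v \<or> v = p \<or> v = q"
proof (cases "M \<subseteq> Poly_Mapping.keys v \<and> Poly_Mapping.keys v \<subseteq> insert a (insert b M)")
  case True
  then have "Poly_Mapping.keys v \<in> {M, insert a M, insert b M, insert a (insert b M)}" by blast
  then show ?thesis
    using keys_inject[OF assms(1) in_V(2)] keys_inject[OF assms(1) in_V(3)] by auto
qed (use assms in auto)

text \<open>A filter inside both sides is inside their intersection \<open>M\<close>, one containing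
  both contains their union, and one that contains one side and is inside the other would make the
  sides comparable.\<close>

lemma comparable_both:
  assumes "comparable v p" "comparable v q" "v \<in> V" "v \<noteq> p" "v \<noteq> q"
  shows "Poly_Mapping.keys v \<subseteq> M \<or> insert a (insert b M) \<subseteq> Poly_Mapping.keys v"
proof -
  have "a \<notin> insert b M" "b \<notin> insert a M" using ab by auto
  then show ?thesis using assms(1,2) unfolding keys_simps by blast
qed

text \<open>The chains form a flag complex whose minimal nonfaces are the incomparable pairs. The
  flip makes \<open>{p, q}\<close> an edge and \<open>{l, u}\<close> a nonface and changes no other
  pair.\<close>

definition flip_complex :: "('a \<Rightarrow>\<^sub>0 real) set set" where
  "flip_complex = {S. S \<subseteq> V \<and> \<not> {l, u} \<subseteq> S \<and> (\<forall>x\<in>S. \<forall>y\<in>S. comparable x y \<or> {x, y} = {p, q})}"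

text \<open>This will be the common link of the flip. Strict inclusion keeps \<open>l\<close> and
  \<open>u\<close> out, and the members are comparable with all four vertices of the
  parallelogram.\<close>

definition outer :: "('a \<Rightarrow>\<^sub>0 real) set set" where
  "outer = {S \<in> chains. \<forall>v\<in>S. Poly_Mapping.keys v \<subset> M \<or> insert a (insert b M) \<subset> Poly_Mapping.keys v}"

lemma flip_complex_subset:
  assumes "S \<in> flip_complex" "S' \<subseteq> S"
  shows "S' \<in> flip_complex"
  using assms unfolding flip_complex_def
proof (elim CollectE conjE, intro CollectI conjI ballI)
  fix x y
  assume "\<forall>x\<in>S. \<forall>y\<in>S. comparable x y \<or> {x, y} = {p, q}" "x \<in> S'" "y \<in> S'"
  with \<open>S' \<subseteq> S\<close> show "comparable x y \<or> {x, y} = {p, q}" by (elim ballE) auto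
qed auto

lemma flip_complexD:
  assumes "S \<in> flip_complex" "x \<in> S" "y \<in> S"
  shows "comparable x y \<or> {x, y} = {p, q}"
proof -
  have "\<forall>x\<in>S. \<forall>y\<in>S. comparable x y \<or> {x, y} = {p, q}"
    using assms(1) unfolding flip_complex_def by (elim CollectE conjE)
  then show ?thesis using assms(2,3) by (elim ballE) auto
qed

lemma flip_complex_chain:
  assumes S: "S \<in> flip_complex" and "\<not> {p, q} \<subseteq> S"
  shows "S \<in> chains"
  unfolding chains_def
proof (intro CollectI conjI ballI)
  show "S \<subseteq> V" using S by (simp add: flip_complex_def)
  fix x y assume xy: "x \<in> S" "y \<in> S"
  then have "{x, y} \<noteq> {p, q}" using assms(2) by (metis empty_subsetI insert_subset)
  then show "comparable x y" using flip_complexD[OF S xy] by argo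
qed

lemma chain_flip_complex:
  assumes "S \<in> chains" "\<not> {l, u} \<subseteq> S"
  shows "S \<in> flip_complex"
  unfolding flip_complex_def
proof (intro CollectI conjI ballI)
  show "S \<subseteq> V" using assms(1) by (simp add: chains_def)
  show "comparable x y \<or> {x, y} = {p, q}" if "x \<in> S" "y \<in> S" for x y
    using chains_comparable[OF assms(1) that] by argo
qed (rule assms(2))

lemma outer_comparable:
  assumes "S \<in> outer" "v \<in> S"
  shows "comparable v l" "comparable v p" "comparable v q" "comparable v u" "v \<notin> {p, q, l, u}"
proof -
  have v: "Poly_Mapping.keys v \<subset> M \<or> insert a (insert b M) \<subset> Poly_Mapping.keys v"
    using assms by (simp add: outer_def)
  then show "comparable v l" "comparable v p" "comparable v q" "comparable v u"
    unfolding keys_simps by blast+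
  have "Poly_Mapping.keys v \<notin> {M, insert a M, insert b M, insert a (insert b M)}" using v ab by blast
  then show "v \<notin> {p, q, l, u}" by auto
qed

text \<open>Together with \<open>chain_outer\<close> this describes the faces around the edge
  \<open>{l, u}\<close> as joins of a part inside the parallelogram with an outer chain;
  \<open>flip_complex_outer\<close> and \<open>outer_flip_complex\<close> do the same for the edge
  \<open>{p, q}\<close> after the flip.\<close>

lemma square_Int_chain:
  assumes "C \<subseteq> {p, l, u} \<or> C \<subseteq> {q, l, u}" "G \<in> outer"
  shows "C \<union> G \<in> chains"
  unfolding chains_def
proof (intro CollectI conjI ballI)
  show "C \<union> G \<subseteq> V" using assms in_V by (auto simp: outer_def chains_def)
  have G: "comparable x y" if "x \<in> G" "y \<in> G" for x y
    using assms(2) that by (simp add: outer_def chains_def)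
  have C: "comparable x y" if "x \<in> C" "y \<in> C" for x y
  proof -
    have "x \<in> {p, l, u} \<and> y \<in> {p, l, u} \<or> x \<in> {q, l, u} \<and> y \<in> {q, l, u}" using assms(1) that by blast
    then show ?thesis by auto
  qed
  have CG: "comparable x y" if "x \<in> C" "y \<in> G" for x y
  proof -
    have "x \<in> {p, q, l, u}" using assms(1) that by blast
    then show ?thesis using outer_comparable[OF assms(2) that(2)] by auto
  qed
  fix x y assume "x \<in> C \<union> G" "y \<in> C \<union> G"
  then show "comparable x y" using G C CG[of x y] CG[of y x] by blast
qed

lemma chain_outer:
  assumes S: "S \<in> chains" "l \<in> S" "u \<in> S"
  shows "S - {p, q, l, u} \<in> outer"
proof -
  have "Poly_Mapping.keys v \<subset> M \<or> insert a (insert b M) \<subset> Poly_Mapping.keys v" if v: "v \<in> S - {p, q, l, u}" for v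
  proof -
    have "v \<in> V" using v S by (auto simp: chains_def)
    moreover have "comparable v l" "comparable v u" using v S chains_comparable by blast+
    ultimately have "Poly_Mapping.keys v \<subseteq> M \<or> insert a (insert b M) \<subseteq> Poly_Mapping.keys v"
      using comparable_cases[of v] v by blast
    moreover have "Poly_Mapping.keys v \<noteq> M" "Poly_Mapping.keys v \<noteq> insert a (insert b M)"
      using keys_inject[OF \<open>v \<in> V\<close> in_V(1)] keys_inject[OF \<open>v \<in> V\<close> in_V(4)] v by auto
    ultimately show ?thesis by blast
  qed
  then show ?thesis using S chains_subset[of S] by (simp add: outer_def)
qed

lemma flip_complex_outer:
  assumes S: "S \<in> flip_complex" "p \<in> S" "q \<in> S"
  shows "S - {p, q, l, u} \<in> outer"
proof -
  have "Poly_Mapping.keys v \<subset> M \<or> insert a (insert b M) \<subset> Poly_Mapping.keys v" if v: "v \<in> S - {p, q, l, u}" for v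
  proof -
    have "v \<in> V" using v S by (auto simp: flip_complex_def)
    moreover have "{v, p} \<noteq> {p, q}" "{v, q} \<noteq> {p, q}" using v by blast+
    then have "comparable v p" "comparable v q"
      using flip_complexD[OF S(1), of v p] flip_complexD[OF S(1), of v q] S v by blast+
    ultimately have "Poly_Mapping.keys v \<subseteq> M \<or> insert a (insert b M) \<subseteq> Poly_Mapping.keys v"
      using comparable_both[of v] v by blast
    moreover have "Poly_Mapping.keys v \<noteq> M" "Poly_Mapping.keys v \<noteq> insert a (insert b M)"
      using keys_inject[OF \<open>v \<in> V\<close> in_V(1)] keys_inject[OF \<open>v \<in> V\<close> in_V(4)] v by auto
    ultimately show ?thesis by blast
  qed
  moreover have "S - {p, q, l, u} \<in> chains"
    using flip_complex_chain[of "S - {p, q, l, u}"] flip_complex_subset[OF S(1)] by blast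
  ultimately show ?thesis by (simp add: outer_def)
qed

lemma outer_flip_complex:
  assumes "C \<subseteq> {p, q, l} \<or> C \<subseteq> {p, q, u}" "G \<in> outer"
  shows "C \<union> G \<in> flip_complex"
  unfolding flip_complex_def
proof (intro CollectI conjI ballI)
  show "C \<union> G \<subseteq> V" using assms in_V by (auto simp: outer_def chains_def)
  have "l \<notin> G" "u \<notin> G" using outer_comparable(5)[OF assms(2)] by blast+
  then show "\<not> {l, u} \<subseteq> C \<union> G" using assms(1) distinct by blast
  have G: "comparable x y" if "x \<in> G" "y \<in> G" for x y
    using assms(2) that by (simp add: outer_def chains_def)
  have C: "comparable x y \<or> {x, y} = {p, q}" if "x \<in> C" "y \<in> C" for x y
  proof -
    have "x \<in> {p, q, l} \<and> y \<in> {p, q, l} \<or> x \<in> {p, q, u} \<and> y \<in> {p, q, u}" using assms(1) that by blast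
    then show ?thesis by auto
  qed
  have CG: "comparable x y" if "x \<in> C" "y \<in> G" for x y
  proof -
    have "x \<in> {p, q, l, u}" using assms(1) that by blast
    then show ?thesis using outer_comparable[OF assms(2) that(2)] by auto
  qed
  fix x y assume "x \<in> C \<union> G" "y \<in> C \<union> G"
  then show "comparable x y \<or> {x, y} = {p, q}" using G C CG[of x y] CG[of y x] by blast
qed

lemma flipped_eq:
  "flipped M {a, b} = {S \<in> T. \<not> {l, u} \<subseteq> S} \<union> {{p, q} \<union> (S - {z}) | S z. S \<in> T \<and> {l, u} \<subseteq> S \<and> z \<in> {l, u}}"
proof -
  have "M \<union> {a, b} = insert a (insert b M)" "(\<lambda>x. indicator_vector (insert x M)) ` {a, b} = {p, q}" by auto
  then show ?thesis unfolding flipped_def by simp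
qed

lemma faces_flipped: "faces (flipped M {a, b}) = flip_complex"
proof
  have "S \<in> flip_complex" if "S \<in> flipped M {a, b}" for S
    using that unfolding flipped_eq
  proof (elim UnE CollectE exE conjE)
    assume "S \<in> T" "\<not> {l, u} \<subseteq> S"
    then show ?thesis using canonical_in_chains chain_flip_complex by simp
  next
    fix C z assume C: "S = {p, q} \<union> (C - {z})" "C \<in> T" "{l, u} \<subseteq> C" "z \<in> {l, u}"
    have "S = (S \<inter> {p, q, l, u}) \<union> (C - {p, q, l, u})" using C by blast
    moreover have "S \<inter> {p, q, l, u} \<subseteq> {p, q, l} \<or> S \<inter> {p, q, l, u} \<subseteq> {p, q, u}"
      using C(1,4) distinct by blast
    moreover have "C - {p, q, l, u} \<in> outer"
      using C chain_outer canonical_in_chains by blast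
    ultimately show ?thesis using outer_flip_complex by metis
  qed
  then show "faces (flipped M {a, b}) \<subseteq> flip_complex"
    using flip_complex_subset by (auto simp: faces_def)
  show "flip_complex \<subseteq> faces (flipped M {a, b})"
  proof
    fix S assume S: "S \<in> flip_complex"
    show "S \<in> faces (flipped M {a, b})"
    proof (cases "{p, q} \<subseteq> S")
      case True
      let ?G = "S - {p, q, l, u}"
      \<comment> \<open>Exchanging \<open>p\<close> and \<open>q\<close> for \<open>l\<close> and
        \<open>u\<close> gives a chain, which extends to a maximal one. \<open>S\<close> is a face
        of the simplex obtained from it by dropping the vertex \<open>z\<close> of
        \<open>{l, u}\<close> that \<open>S\<close> misses.\<close>
      have "{l, u} \<union> ?G \<in> chains"
        using square_Int_chain[of "{l, u}"] flip_complex_outer[OF S] True by blast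
      then obtain C where C: "C \<in> T" "{l, u} \<union> ?G \<subseteq> C"
        unfolding faces_canonical[symmetric] faces_def by blast
      obtain z where "z \<in> {l, u}" "z \<notin> S" using S by (auto simp: flip_complex_def)
      then have "{p, q} \<union> (C - {z}) \<in> flipped M {a, b}" "S \<subseteq> {p, q} \<union> (C - {z})"
        using C unfolding flipped_eq by blast+
      then show ?thesis unfolding faces_def by blast
    next
      case False
      then have "S \<in> chains" using flip_complex_chain S by blast
      then obtain C where C: "C \<in> T" "S \<subseteq> C"
        unfolding faces_canonical[symmetric] faces_def by blast
      \<comment> \<open>\<open>S\<close> misses \<open>l\<close> or \<open>u\<close>, but the
        maximal chain around it may contain both. Such a chain has been removed, and one of its
        replacements contains \<open>S\<close>.\<close>
      show ?thesis
      proof (cases "{l, u} \<subseteq> C")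
        case True
        obtain z where "z \<in> {l, u}" "z \<notin> S" using S by (auto simp: flip_complex_def)
        then have "{p, q} \<union> (C - {z}) \<in> flipped M {a, b}" "S \<subseteq> {p, q} \<union> (C - {z})"
          using C True unfolding flipped_eq by blast+
        then show ?thesis unfolding faces_def by blast
      next
        case False
        then have "C \<in> flipped M {a, b}" using C unfolding flipped_eq by blast
        then show ?thesis using C(2) unfolding faces_def by blast
      qed
    qed
  qed
qed

text \<open>Coefficients of the dependence \<open>p + q - l - u = 0\<close>, extended by
  zero.\<close>

definition sgn_dep :: "('a \<Rightarrow>\<^sub>0 real) \<Rightarrow> real" where
  "sgn_dep v = (if v \<in> {p, q} then 1 else if v \<in> {l, u} then -1 else 0)"

lemma sgn_dep_simps [simp]: "sgn_dep p = 1" "sgn_dep q = 1" "sgn_dep l = -1" "sgn_dep u = -1"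
  "v \<notin> {p, q, l, u} \<Longrightarrow> sgn_dep v = 0"
  by (auto simp: sgn_dep_def)

lemma sgn_dep_sum:
  assumes "finite S" "{p, q, l, u} \<subseteq> S"
  shows "sum sgn_dep S = 0" "(\<Sum>v\<in>S. sgn_dep v *\<^sub>R v) = 0"
proof -
  have "sum sgn_dep S = sum sgn_dep {p, q, l, u}"
    using assms by (intro sum.mono_neutral_right) auto
  then show "sum sgn_dep S = 0" by simp
  have "(\<Sum>v\<in>S. sgn_dep v *\<^sub>R v) = (\<Sum>v\<in>{p, q, l, u}. sgn_dep v *\<^sub>R v)"
    using assms by (intro sum.mono_neutral_right) auto
  also have "\<dots> = (p + q) - (l + u)" by simp
  finally show "(\<Sum>v\<in>S. sgn_dep v *\<^sub>R v) = 0" by (simp add: sum_eq)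
qed

lemma shift_sums:
  "(\<Sum>v\<in>V. c v + t * sgn_dep v) = sum c V"
  "(\<Sum>v\<in>V. (c v + t * sgn_dep v) *\<^sub>R v) = (\<Sum>v\<in>V. c v *\<^sub>R v)"
proof -
  have "{p, q, l, u} \<subseteq> V" using in_V by simp
  note e = sgn_dep_sum[OF finite_V this]
  show "(\<Sum>v\<in>V. c v + t * sgn_dep v) = sum c V"
    using e(1) by (simp add: sum.distrib sum_distrib_left[symmetric])
  have "(\<Sum>v\<in>V. (c v + t * sgn_dep v) *\<^sub>R v) = (\<Sum>v\<in>V. c v *\<^sub>R v) + t *\<^sub>R (\<Sum>v\<in>V. sgn_dep v *\<^sub>R v)"
    by (simp add: scaleR_add_left sum.distrib scaleR_right.sum)
  then show "(\<Sum>v\<in>V. (c v + t * sgn_dep v) *\<^sub>R v) = (\<Sum>v\<in>V. c v *\<^sub>R v)"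
    using e(2) by simp
qed

text \<open>The smaller of the weights of \<open>p\<close> and \<open>q\<close> is the largest
  amount that can be shifted to \<open>l\<close> and \<open>u\<close> without negative weights. It
  empties one of the two sides, so no incomparable pair is left in the support.\<close>

lemma weighting_to_chains:
  assumes c: "weighting flip_complex c"
  shows "weighting chains (\<lambda>v. c v + - min (c p) (c q) * sgn_dep v)"
proof -
  define m where "m = min (c p) (c q)"
  define d where "d v = c v + - m * sgn_dep v" for v
  have nn: "\<And>v. 0 \<le> c v" and supp: "{v. c v \<noteq> 0} \<in> flip_complex" using c by (auto simp: weighting_def)
  have "0 \<le> m" using nn by (simp add: m_def)
  have m_le: "m \<le> c p" "m \<le> c q" by (simp_all add: m_def)
  have vals: "d p = c p - m" "d q = c q - m" "d l = c l + m" "d u = c u + m"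
    by (simp_all add: d_def)
  have other: "d v = c v" if "v \<notin> {p, q, l, u}" for v using that by (simp add: d_def)
  have nonneg: "0 \<le> d v" for v
    using other[of v] vals m_le nn[of v] nn[of l] nn[of u] \<open>0 \<le> m\<close> by (cases "v \<in> {p, q, l, u}") auto
  have "{v. d v \<noteq> 0} \<in> chains"
  proof (cases "m = 0")
    case True
    then have "d = c" by (auto simp: d_def)
    moreover have "c p = 0 \<or> c q = 0" using True by (auto simp: m_def min_def split: if_splits)
    ultimately show ?thesis using flip_complex_chain[OF supp] by auto
  next
    \<comment> \<open>With both sides in the support, the rest of it is outer and stays a chain when
      \<open>l\<close> and \<open>u\<close> are added.\<close>
    case False
    then have "c p \<noteq> 0" "c q \<noteq> 0" using m_le nn \<open>0 \<le> m\<close> by (metis order_antisym)+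
    then have outer: "{v. c v \<noteq> 0} - {p, q, l, u} \<in> outer"
      using flip_complex_outer[OF supp] by simp
    have "d p = 0 \<or> d q = 0" unfolding vals m_def by auto
    then have "{v. d v \<noteq> 0} \<inter> {p, q, l, u} \<subseteq> {p, l, u} \<or> {v. d v \<noteq> 0} \<inter> {p, q, l, u} \<subseteq> {q, l, u}"
      by blast
    then have "({v. d v \<noteq> 0} \<inter> {p, q, l, u}) \<union> ({v. c v \<noteq> 0} - {p, q, l, u}) \<in> chains"
      using square_Int_chain outer by blast
    moreover have "v \<in> {v. d v \<noteq> 0} \<longleftrightarrow>
        v \<in> ({v. d v \<noteq> 0} \<inter> {p, q, l, u}) \<union> ({v. c v \<noteq> 0} - {p, q, l, u})" for v
      using other[of v] by (cases "v \<in> {p, q, l, u}") auto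
    then have "{v. d v \<noteq> 0} = ({v. d v \<noteq> 0} \<inter> {p, q, l, u}) \<union> ({v. c v \<noteq> 0} - {p, q, l, u})"
      by (rule set_eqI)
    ultimately show ?thesis by simp
  qed
  then show ?thesis using nonneg by (simp add: weighting_def d_def m_def)
qed

text \<open>The shift in the opposite direction empties \<open>l\<close> or \<open>u\<close>, so the
  forbidden edge disappears while both sides may gain weight.\<close>

lemma weighting_to_flip_complex:
  assumes c: "weighting chains c"
  shows "weighting flip_complex (\<lambda>v. c v + min (c l) (c u) * sgn_dep v)"
proof -
  define m where "m = min (c l) (c u)"
  define d where "d v = c v + m * sgn_dep v" for v
  have nn: "\<And>v. 0 \<le> c v" and supp: "{v. c v \<noteq> 0} \<in> chains" using c by (auto simp: weighting_def)
  have "0 \<le> m" using nn by (simp add: m_def)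
  have m_le: "m \<le> c l" "m \<le> c u" by (simp_all add: m_def)
  have vals: "d p = c p + m" "d q = c q + m" "d l = c l - m" "d u = c u - m"
    by (simp_all add: d_def)
  have other: "d v = c v" if "v \<notin> {p, q, l, u}" for v using that by (simp add: d_def)
  have nonneg: "0 \<le> d v" for v
    using other[of v] vals m_le nn[of v] nn[of p] nn[of q] \<open>0 \<le> m\<close> by (cases "v \<in> {p, q, l, u}") auto
  have "{v. d v \<noteq> 0} \<in> flip_complex"
  proof (cases "m = 0")
    case True
    then have "d = c" by (auto simp: d_def)
    moreover have "c l = 0 \<or> c u = 0" using True by (auto simp: m_def min_def split: if_splits)
    ultimately show ?thesis using chain_flip_complex[OF supp] by auto
  next
    case False
    then have "c l \<noteq> 0" "c u \<noteq> 0" using m_le nn \<open>0 \<le> m\<close> by (metis order_antisym)+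
    then have outer: "{v. c v \<noteq> 0} - {p, q, l, u} \<in> outer"
      using chain_outer[OF supp] by simp
    have "d l = 0 \<or> d u = 0" unfolding vals m_def by auto
    then have "{v. d v \<noteq> 0} \<inter> {p, q, l, u} \<subseteq> {p, q, l} \<or> {v. d v \<noteq> 0} \<inter> {p, q, l, u} \<subseteq> {p, q, u}"
      by blast
    then have "({v. d v \<noteq> 0} \<inter> {p, q, l, u}) \<union> ({v. c v \<noteq> 0} - {p, q, l, u}) \<in> flip_complex"
      using outer_flip_complex outer by blast
    moreover have "v \<in> {v. d v \<noteq> 0} \<longleftrightarrow>
        v \<in> ({v. d v \<noteq> 0} \<inter> {p, q, l, u}) \<union> ({v. c v \<noteq> 0} - {p, q, l, u})" for v
      using other[of v] by (cases "v \<in> {p, q, l, u}") auto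
    then have "{v. d v \<noteq> 0} = ({v. d v \<noteq> 0} \<inter> {p, q, l, u}) \<union> ({v. c v \<noteq> 0} - {p, q, l, u})"
      by (rule set_eqI)
    ultimately show ?thesis by simp
  qed
  then show ?thesis using nonneg by (simp add: weighting_def d_def m_def)
qed

text \<open>After shifting, both weightings live on chains and agree there. It remains to recover
  the amount of the shift: before it, \<open>l\<close> or \<open>u\<close> has weight 0, so after it
  the smaller of their two weights is exactly that amount.\<close>

lemma unique_weights_flip_complex: "unique_weights V flip_complex"
  unfolding unique_weights_def
proof (intro allI impI, elim conjE)
  fix c d
  assume c: "weighting flip_complex c" and d: "weighting flip_complex d" and total: "sum c V = sum d V"
    and eq: "(\<Sum>v\<in>V. c v *\<^sub>R v) = (\<Sum>v\<in>V. d v *\<^sub>R v)"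
  have recover: "min (f l + min (f p) (f q)) (f u + min (f p) (f q)) = min (f p) (f q)"
    if "weighting flip_complex f" for f
  proof -
    have "f l = 0 \<or> f u = 0" "0 \<le> f l" "0 \<le> f u"
      using that by (auto simp: weighting_def flip_complex_def)
    then show ?thesis by auto
  qed
  define s where "s = min (c p) (c q)"
  define t where "t = min (d p) (d q)"
  have E: "(\<lambda>v. c v + - s * sgn_dep v) = (\<lambda>v. d v + - t * sgn_dep v)"
    unfolding s_def t_def
    by (rule unique_weightsD[OF unique_weights_chains weighting_to_chains[OF c] weighting_to_chains[OF d]])
       (simp_all only: shift_sums total eq)
  from fun_cong[OF E, of l] fun_cong[OF E, of u] have "c l + s = d l + t" "c u + s = d u + t" by simp_all
  then have "s = t" using recover[OF c] recover[OF d] by (simp add: s_def t_def)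
  show "c = d"
  proof
    fix v show "c v = d v" using fun_cong[OF E, of v] \<open>s = t\<close> by simp
  qed
qed

section \<open>The flipped simplices triangulate the order polytope\<close>

lemma flipped_subset_V:
  assumes "S \<in> flipped M {a, b}"
  shows "S \<subseteq> V"
proof -
  have "S \<in> faces (flipped M {a, b})" using assms by (auto simp: faces_def)
  then show ?thesis by (simp add: faces_flipped flip_complex_def)
qed

lemma affine_hull_flipped:
  assumes "S \<in> flipped M {a, b}"
  shows "P \<subseteq> affine hull S"
  using assms unfolding flipped_eq
proof (elim UnE CollectE exE conjE)
  assume "S \<in> T"
  then show ?thesis by (rule affine_hull_canonical)
next
  fix C z assume C: "S = {p, q} \<union> (C - {z})" "C \<in> T" "{l, u} \<subseteq> C" "z \<in> {l, u}"
  \<comment> \<open>The dropped vertex \<open>z\<close> returns as \<open>p + q - z'\<close>, an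
    affine combination since its coefficients add up to 1.\<close>
  obtain z' where z': "z = l \<and> z' = u \<or> z = u \<and> z' = l" using C(4) by blast
  then have "z + z' = p + q" unfolding sum_eq by (auto simp: add.commute)
  then have z: "z = 1 *\<^sub>R p + 1 *\<^sub>R q + (-1) *\<^sub>R z'" by (simp add: algebra_simps)
  have "{p, q, z'} \<subseteq> S" using C(1,3) z' distinct(3,9) by auto
  also have "S \<subseteq> affine hull S" by (rule hull_subset)
  finally have "{p, q, z'} \<subseteq> affine hull S" .
  then have "z \<in> affine hull S" by (subst z) (intro mem_affine_3, auto)
  moreover have "C - {z} \<subseteq> affine hull S" using C(1) hull_subset[of S affine] by blast
  ultimately have "C \<subseteq> affine hull S" by blast
  then have "affine hull C \<subseteq> affine hull S" by (simp add: hull_minimal)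
  then show ?thesis using affine_hull_canonical[OF C(2)] by blast
qed

lemma vertex_triangulation_flipped: "vertex_triangulation P (flipped M {a, b})"
proof (rule vertex_triangulationI[OF finite_V V_subset_vertices convex_P flipped_subset_V])
  show "affine hull S = affine hull P" if "S \<in> flipped M {a, b}" for S
    using affine_hull_eq_P flipped_subset_V affine_hull_flipped that by blast
  show "unique_weights V (faces (flipped M {a, b}))"
    using unique_weights_flip_complex by (simp add: faces_flipped)
  fix x assume "x \<in> P"
  then obtain c where c: "weighting chains c" "sum c V = 1" "(\<Sum>v\<in>V. c v *\<^sub>R v) = x"
    using exists_chain_weighting by blast
  define d where "d = (\<lambda>v. c v + min (c l) (c u) * sgn_dep v)"
  have d: "weighting flip_complex d" "sum d V = 1" "(\<Sum>v\<in>V. d v *\<^sub>R v) = x"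
    unfolding d_def using weighting_to_flip_complex[OF c(1)] c(2,3) by (simp_all only: shift_sums)
  then obtain S where S: "S \<in> flipped M {a, b}" "{v. d v \<noteq> 0} \<subseteq> S"
    unfolding weighting_def faces_flipped[symmetric] faces_def by blast
  then have "x \<in> convex hull S"
    using d by (subst convex_hull_weights[OF finite_V flipped_subset_V[OF S(1)]]) (auto simp: weighting_def)
  with S(1) show "\<exists>S\<in>flipped M {a, b}. x \<in> convex hull S" by blast
qed

end

section \<open>Flippable circuits\<close>

context square
begin

lemma circuit_triangulation_square:
  "circuit_triangulation {p, q, l, u} {p, q} = {{q, l, u}, {p, l, u}}"
  "circuit_triangulation {p, q, l, u} {l, u} = {{p, q, u}, {p, q, l}}"
proof -
  have "{p, q, l, u} - {p} = {q, l, u}" "{p, q, l, u} - {q} = {p, l, u}"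
    "{p, q, l, u} - {l} = {p, q, u}" "{p, q, l, u} - {u} = {p, q, l}"
    by auto
  moreover have "circuit_triangulation Z X = (\<lambda>z. Z - {z}) ` X" for Z X :: "('a \<Rightarrow>\<^sub>0 real) set"
    by (auto simp: circuit_triangulation_def)
  ultimately show "circuit_triangulation {p, q, l, u} {p, q} = {{q, l, u}, {p, l, u}}"
    "circuit_triangulation {p, q, l, u} {l, u} = {{p, q, u}, {p, q, l}}"
    by simp_all
qed

text \<open>The other side cannot enter the link because it is incomparable with \<open>v\<close>,
  and any other vertex comparable with \<open>l\<close> and \<open>u\<close> lies outside the
  parallelogram.\<close>

lemma link_square:
  assumes "v = p \<or> v = q"
  shows "link chains {v, l, u} = outer"
proof
  show "outer \<subseteq> link chains {v, l, u}"
  proof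
    fix G assume G: "G \<in> outer"
    have "G \<inter> {p, q, l, u} = {}" using outer_comparable(5)[OF G] by blast
    then have "G \<inter> {v, l, u} = {}" using assms by blast
    moreover have "{v, l, u} \<union> G \<in> chains" using square_Int_chain[OF _ G, of "{v, l, u}"] assms by blast
    ultimately show "G \<in> link chains {v, l, u}"
      using G by (simp add: link_def outer_def Un_commute)
  qed
  show "link chains {v, l, u} \<subseteq> outer"
  proof
    fix G assume "G \<in> link chains {v, l, u}"
    then have G: "G \<inter> {v, l, u} = {}" "G \<union> {v, l, u} \<in> chains"
      by (auto simp: link_def)
    have "{p, q} \<inter> G = {}"
      using chains_comparable[OF G(2), of p q] incomparable assms G(1) by blast
    then have "G \<subseteq> (G \<union> {v, l, u}) - {p, q, l, u}" using G(1) by blast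
    moreover have "(G \<union> {v, l, u}) - {p, q, l, u} \<in> outer"
      by (rule chain_outer[OF G(2)]) auto
    ultimately show "G \<in> outer"
      using chains_subset unfolding outer_def by blast
  qed
qed

lemma join_faces_pair: "join (faces {C1, C2}) K = {C \<union> G | C G. (C \<subseteq> C2 \<or> C \<subseteq> C1) \<and> G \<in> K}"
proof -
  have "faces {C1, C2} = {C. C \<subseteq> C2 \<or> C \<subseteq> C1}" by (auto simp: faces_def)
  then show ?thesis by (simp add: join_def)
qed

text \<open>The two joins overlap: a removed face that misses \<open>l\<close> or \<open>u\<close>
  is returned by the second join. The net loss consists of the faces with both \<open>l\<close> and
  \<open>u\<close>, the net gain of those with both \<open>p\<close> and \<open>q\<close>.\<close>

lemma flip_faces:
  "(chains - join (faces {{q, l, u}, {p, l, u}}) outer) \<union> join (faces {{p, q, u}, {p, q, l}}) outer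
    = flip_complex"
  unfolding join_faces_pair
proof (intro equalityI subsetI)
  fix S
  assume S: "S \<in> (chains - {C \<union> G | C G. (C \<subseteq> {p, l, u} \<or> C \<subseteq> {q, l, u}) \<and> G \<in> outer}) \<union>
    {C \<union> G | C G. (C \<subseteq> {p, q, l} \<or> C \<subseteq> {p, q, u}) \<and> G \<in> outer}"
  show "S \<in> flip_complex"
  proof (cases "S \<in> {C \<union> G | C G. (C \<subseteq> {p, q, l} \<or> C \<subseteq> {p, q, u}) \<and> G \<in> outer}")
    case True
    then show ?thesis using outer_flip_complex by blast
  next
    case False
    then have ch: "S \<in> chains"
      and no: "S \<notin> {C \<union> G | C G. (C \<subseteq> {p, l, u} \<or> C \<subseteq> {q, l, u}) \<and> G \<in> outer}"
      using S by blast+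
    have "\<not> {l, u} \<subseteq> S"
    proof
      assume lu: "{l, u} \<subseteq> S"
      then have "S - {p, q, l, u} \<in> outer" using chain_outer[OF ch] by simp
      moreover have "\<not> (p \<in> S \<and> q \<in> S)" using chains_comparable[OF ch, of p q] incomparable by argo
      then have "S \<inter> {p, q, l, u} \<subseteq> {p, l, u} \<or> S \<inter> {p, q, l, u} \<subseteq> {q, l, u}" by blast
      moreover have "S = (S \<inter> {p, q, l, u}) \<union> (S - {p, q, l, u})" by blast
      ultimately show False using no by blast
    qed
    then show ?thesis using chain_flip_complex[OF ch] by blast
  qed
next
  fix S assume S: "S \<in> flip_complex"
  show "S \<in> (chains - {C \<union> G | C G. (C \<subseteq> {p, l, u} \<or> C \<subseteq> {q, l, u}) \<and> G \<in> outer}) \<union>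
    {C \<union> G | C G. (C \<subseteq> {p, q, l} \<or> C \<subseteq> {p, q, u}) \<and> G \<in> outer}"
  proof (cases "{p, q} \<subseteq> S")
    case True
    then have "S - {p, q, l, u} \<in> outer" using flip_complex_outer[OF S] by simp
    moreover have "\<not> {l, u} \<subseteq> S" using S by (simp add: flip_complex_def)
    then have "S \<inter> {p, q, l, u} \<subseteq> {p, q, l} \<or> S \<inter> {p, q, l, u} \<subseteq> {p, q, u}" by blast
    moreover have "S = (S \<inter> {p, q, l, u}) \<union> (S - {p, q, l, u})" by blast
    ultimately show ?thesis by blast
  next
    case False
    then have ch: "S \<in> chains" using flip_complex_chain[OF S] by simp
    have "\<exists>C G. S = C \<union> G \<and> (C \<subseteq> {p, q, l} \<or> C \<subseteq> {p, q, u}) \<and> G \<in> outer"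
      if CG: "S = C \<union> G" "C \<subseteq> {p, l, u} \<or> C \<subseteq> {q, l, u}" "G \<in> outer" for C G
    proof -
      have "\<not> {l, u} \<subseteq> S" using S by (simp add: flip_complex_def)
      then have "C \<subseteq> {p, q, l} \<or> C \<subseteq> {p, q, u}" using CG(1,2) by blast
      then show ?thesis using CG by blast
    qed
    then show ?thesis using ch by blast
  qed
qed

lemma square_dependent: "affine_dependent {p, q, l, u}"
proof -
  have "sum sgn_dep {p, q, l, u} = 0" "(\<Sum>v\<in>{p, q, l, u}. sgn_dep v *\<^sub>R v) = 0"
    by (rule sgn_dep_sum; simp)+
  moreover have "\<exists>v\<in>{p, q, l, u}. sgn_dep v \<noteq> 0" by simp
  ultimately show ?thesis
    unfolding affine_dependent_explicit_finite[OF finite.insertI[OF finite.insertI[OF finite.insertI[OF finite.insertI[OF finite.emptyI]]]]]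
    by blast
qed

text \<open>A proper subset misses a side and is then a chain, or misses \<open>l\<close> or
  \<open>u\<close> and is then a face of the flipped complex. Both complexes have unique weights,
  hence affinely independent faces.\<close>

lemma square_circuit: "circuit {p, q, l, u}"
proof -
  have empty: "{} \<in> outer" by (simp add: outer_def chains_def)
  have "\<not> affine_dependent Y" if Y: "Y \<subset> {p, q, l, u}" for Y
  proof -
    consider "Y \<subseteq> {p, l, u} \<or> Y \<subseteq> {q, l, u}" | "Y \<subseteq> {p, q, l} \<or> Y \<subseteq> {p, q, u}"
      using Y by blast
    then show ?thesis
    proof cases
      case 1
      then show ?thesis
        using square_Int_chain[OF _ empty, of Y] chains_affine_independent by simp
    next
      case 2
      then have Y: "Y \<in> flip_complex" using outer_flip_complex[OF _ empty, of Y] by simp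
      show ?thesis
      proof (rule unique_weights_affine_independent[OF finite_V _ _ unique_weights_flip_complex])
        show "Y \<subseteq> V" using Y by (simp add: flip_complex_def)
        show "Pow Y \<subseteq> flip_complex" using flip_complex_subset[OF Y] by blast
      qed
    qed
  qed
  then show ?thesis using square_dependent by (simp add: circuit_def)
qed

lemma square_signs: "circuit_signs {p, q, l, u} {p, q} {l, u}"
  unfolding circuit_signs_def
proof (intro exI[of _ sgn_dep] conjI)
  show "sum sgn_dep {p, q, l, u} = 0" "(\<Sum>v\<in>{p, q, l, u}. sgn_dep v *\<^sub>R v) = 0"
    by (rule sgn_dep_sum; simp)+
  show "\<exists>v\<in>{p, q, l, u}. sgn_dep v \<noteq> 0" by simp
  show "{p, q} = {z \<in> {p, q, l, u}. 0 < sgn_dep z}" "{l, u} = {z \<in> {p, q, l, u}. sgn_dep z < 0}"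
    by (auto simp: sgn_dep_def)
qed

lemma differ_by_flip_flipped:
  assumes "faces T' = flip_complex"
  shows "differ_by_flip P T T'"
  unfolding differ_by_flip_def
proof (intro exI conjI)
  show "{p, q, l, u} \<subseteq> vertices P" using in_V V_subset_vertices by blast
  show "faces (circuit_triangulation {p, q, l, u} {p, q}) \<subseteq> faces T"
  proof
    fix C assume "C \<in> faces (circuit_triangulation {p, q, l, u} {p, q})"
    then have "C \<subseteq> {p, l, u} \<or> C \<subseteq> {q, l, u}"
      unfolding circuit_triangulation_square faces_def by blast
    moreover have "{} \<in> outer" by (simp add: outer_def chains_def)
    ultimately show "C \<in> faces T"
      using square_Int_chain[of C "{}"] by (simp add: faces_canonical)
  qed
  show "\<forall>S\<in>circuit_triangulation {p, q, l, u} {p, q}. link (faces T) S = outer"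
    unfolding circuit_triangulation_square faces_canonical using link_square by simp
  show "faces T' = (faces T - join (faces (circuit_triangulation {p, q, l, u} {p, q})) outer)
      \<union> join (faces (circuit_triangulation {p, q, l, u} {l, u})) outer"
    unfolding circuit_triangulation_square faces_canonical flip_faces by (rule assms)
qed (rule square_circuit square_signs)+

end

section \<open>Classification of the flippable circuits\<close>

context finite_poset
begin

text \<open>Deleting any one element of \<open>X\<close> from \<open>Z\<close> leaves a chain, while
  \<open>Z\<close>, being dependent, is not a chain. Once this shows \<open>X\<close> to be an
  incomparable pair, uniqueness of chain weights forces the negative part.\<close>

lemma circuit_square:
  assumes ZP: "Z \<subseteq> vertices P" and circ: "circuit Z" and signs: "circuit_signs Z X Y"
    and plus: "faces (circuit_triangulation Z X) \<subseteq> chains"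
  obtains p q where "p \<in> V" "q \<in> V" "\<not> comparable p q" "X = {p, q}"
    "Y = {indicator_vector (Poly_Mapping.keys p \<inter> Poly_Mapping.keys q),
          indicator_vector (Poly_Mapping.keys p \<union> Poly_Mapping.keys q)}"
    "Z = X \<union> Y"
proof -
  obtain c where c: "sum c Z = 0" "(\<Sum>z\<in>Z. c z *\<^sub>R z) = 0" "\<exists>z\<in>Z. c z \<noteq> 0"
    and X: "X = {z \<in> Z. c z > 0}" and Y: "Y = {z \<in> Z. c z < 0}"
    using signs unfolding circuit_signs_def by blast
  have finZ: "finite Z" and dep: "affine_dependent Z"
    and min: "\<And>Z'. Z' \<subset> Z \<Longrightarrow> \<not> affine_dependent Z'"
    using circ by (auto simp: circuit_def)
  have rest: "Z - {z} \<in> chains" if "z \<in> X" for z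
    using plus that unfolding circuit_triangulation_def faces_def by blast
  have not_chain: "Z \<notin> chains" using chains_affine_independent dep by blast
  have "X \<noteq> {}"
  proof
    assume "X = {}"
    then have "\<forall>z\<in>Z. 0 \<le> - c z" using X by force
    moreover have "(\<Sum>z\<in>Z. - c z) = 0" using c(1) by (simp add: sum_negf)
    ultimately have "\<forall>z\<in>Z. - c z = 0" using finZ sum_nonneg_eq_0_iff[of Z "\<lambda>z. - c z"] by simp
    then show False using c(3) by simp
  qed
  then obtain p where p: "p \<in> X" by blast
  \<comment> \<open>A single positive vertex would be a convex combination of the remaining ones,
    although it is an extreme point.\<close>
  have "\<exists>q\<in>X. q \<noteq> p"
  proof (rule ccontr)
    assume "\<not> ?thesis"
    then have np: "c z \<le> 0" if "z \<in> Z - {p}" for z using that X by force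
    have pZ: "p \<in> Z" "c p > 0" using p X by auto
    have "sum c (Z - {p}) = - c p" using sum.remove[OF finZ pZ(1), of c] c(1) by simp
    then have s1: "(\<Sum>z\<in>Z - {p}. - c z / c p) = 1"
      using pZ(2) by (simp add: sum_divide_distrib[symmetric] sum_negf)
    have "(\<Sum>z\<in>Z - {p}. c z *\<^sub>R z) = - (c p *\<^sub>R p)"
      using sum.remove[OF finZ pZ(1), of "\<lambda>z. c z *\<^sub>R z"] c(2) by (simp add: eq_neg_iff_add_eq_0 add.commute)
    moreover have "(\<Sum>z\<in>Z - {p}. (- c z / c p) *\<^sub>R z) = (- 1 / c p) *\<^sub>R (\<Sum>z\<in>Z - {p}. c z *\<^sub>R z)"
      by (simp add: scaleR_right.sum)
    ultimately have s2: "(\<Sum>z\<in>Z - {p}. (- c z / c p) *\<^sub>R z) = p" using pZ(2) by simp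
    have "convex (P - {p})" "Z - {p} \<subseteq> P - {p}"
      using ZP pZ(1) extreme_point_of_stillconvex[OF convex_P, of p]
      by (auto simp: vertices_def extreme_point_of_def)
    then have "(\<Sum>z\<in>Z - {p}. (- c z / c p) *\<^sub>R z) \<in> P - {p}"
      using finZ s1 np pZ(2) by (intro convex_sum) (auto simp: divide_nonpos_pos)
    then show False using s2 by simp
  qed
  then obtain q where q: "q \<in> X" "q \<noteq> p" by blast
  have pqZ: "p \<in> Z" "q \<in> Z" "c p > 0" "c q > 0" using p q X by auto
  have ZV: "Z \<subseteq> V" using rest[OF p] rest[OF q(1)] q(2) unfolding chains_def by blast
  have pqV: "p \<in> V" "q \<in> V" using ZV pqZ by auto
  \<comment> \<open>Every pair in \<open>Z\<close> other than \<open>p\<close>, \<open>q\<close>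
    survives in \<open>Z - {p}\<close> or in \<open>Z - {q}\<close>, so \<open>p\<close> and
    \<open>q\<close> must be the pair that keeps \<open>Z\<close> from being a chain.\<close>
  have inc: "\<not> comparable p q"
  proof
    assume "comparable p q"
    then have "comparable x y" if "x \<in> Z" "y \<in> Z" for x y
      using chains_comparable[OF rest[OF p], of x y] chains_comparable[OF rest[OF q(1)], of x y] that q(2)
      by blast
    then show False using not_chain ZV by (simp add: chains_def)
  qed
  have X_eq: "X = {p, q}"
  proof (rule ccontr)
    assume "X \<noteq> {p, q}"
    then obtain z where "z \<in> X" "z \<noteq> p" "z \<noteq> q" using p q by blast
    then show False using chains_comparable[OF rest[of z], of p q] pqZ inc by blast
  qed
  define l where "l = (indicator_vector (Poly_Mapping.keys p \<inter> Poly_Mapping.keys q) :: 'a \<Rightarrow>\<^sub>0 real)"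
  define u where "u = (indicator_vector (Poly_Mapping.keys p \<union> Poly_Mapping.keys q) :: 'a \<Rightarrow>\<^sub>0 real)"
  have lu: "l \<in> V" "u \<in> V"
    unfolding l_def u_def using pqV by (simp_all add: indicator_in_V Int_filter Un_filter keys_V)
  have keys: "Poly_Mapping.keys l = Poly_Mapping.keys p \<inter> Poly_Mapping.keys q"
    "Poly_Mapping.keys u = Poly_Mapping.keys p \<union> Poly_Mapping.keys q"
    unfolding l_def u_def by (simp_all add: keys_indicator_vector)
  have neq: "l \<noteq> p" "l \<noteq> q" "u \<noteq> p" "u \<noteq> q" "l \<noteq> u" using keys inc by auto
  \<comment> \<open>Two chain weightings represent the positive part of the dependence:
    \<open>f\<close> moves the amount \<open>m\<close> from \<open>p\<close> and \<open>q\<close> to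
    \<open>l\<close> and \<open>u\<close>, which empties the lighter side, and \<open>g\<close> is
    the negative part of \<open>c\<close> with its sign changed. Their equality determines
    \<open>Y\<close>.\<close>
  define m where "m = min (c p) (c q)"
  have m: "m > 0" "m \<le> c p" "m \<le> c q" using pqZ by (simp_all add: m_def)
  define f where "f v = (if v = p then c p - m else 0) + (if v = q then c q - m else 0)
      + (if v = l then m else 0) + (if v = u then m else 0)" for v
  define g where "g v = (if v \<in> Y then - c v else 0)" for v
  have f_vals: "f p = c p - m" "f q = c q - m" "f l = m" "f u = m"
    using neq q(2) by (simp_all add: f_def)
  have f_zero: "f v = 0" if "v \<notin> {p, q, l, u}" for v using that by (simp add: f_def)
  have wf: "weighting chains f"
  proof -
    have "f p = 0 \<or> f q = 0" unfolding f_vals m_def by auto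
    moreover have "{v. f v \<noteq> 0} \<subseteq> {p, q, l, u} - {x}" if "f x = 0" for x
    proof
      fix v assume "v \<in> {v. f v \<noteq> 0}"
      then have "f v \<noteq> 0" by simp
      then have "v \<noteq> x" "v \<in> {p, q, l, u}" using that f_zero[of v] by auto
      then show "v \<in> {p, q, l, u} - {x}" by simp
    qed
    moreover have "{p, q, l, u} - {q} \<subseteq> {p, l, u}" "{p, q, l, u} - {p} \<subseteq> {q, l, u}" by auto
    ultimately have "{v. f v \<noteq> 0} \<subseteq> {p, l, u} \<or> {v. f v \<noteq> 0} \<subseteq> {q, l, u}"
      by (meson order_trans)
    moreover have "{p, l, u} \<in> chains" "{q, l, u} \<in> chains"
      unfolding chains_def using pqV lu keys by auto
    ultimately have "{v. f v \<noteq> 0} \<in> chains" using chains_subset by blast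
    then show ?thesis using m by (auto simp: weighting_def f_def)
  qed
  have wg: "weighting chains g"
  proof -
    have "{v. g v \<noteq> 0} \<subseteq> Z - {p}" using pqZ by (auto simp: g_def Y)
    then have "{v. g v \<noteq> 0} \<in> chains" using chains_subset rest[OF p] by blast
    then show ?thesis by (auto simp: weighting_def g_def Y)
  qed
  have cg: "c v = (if v = p then c p else 0) + (if v = q then c q else 0) - g v" if "v \<in> Z" for v
  proof -
    have "v = p \<or> v = q \<or> c v \<le> 0" using that X_eq X by force
    then show ?thesis using that pqZ q(2) by (auto simp: g_def Y)
  qed
  have scale: "(if v = x then t else 0) *\<^sub>R v = (if v = x then t *\<^sub>R x else 0)" for v x :: "'a \<Rightarrow>\<^sub>0 real" and t :: real
    by simp
  have g_sum: "sum g V = c p + c q" "(\<Sum>v\<in>V. g v *\<^sub>R v) = c p *\<^sub>R p + c q *\<^sub>R q"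
  proof -
    have gV: "sum g V = sum g Z" "(\<Sum>v\<in>V. g v *\<^sub>R v) = (\<Sum>v\<in>Z. g v *\<^sub>R v)"
      by (rule sum_supported[OF finite_V ZV], simp add: g_def Y)+
    have "sum c Z = (\<Sum>v\<in>Z. (if v = p then c p else 0) + (if v = q then c q else 0) - g v)"
      using cg by (rule sum.cong[OF refl])
    then show "sum g V = c p + c q"
      using finZ pqZ c(1) gV(1) by (simp add: sum.distrib sum_subtractf)
    have "(\<Sum>v\<in>Z. c v *\<^sub>R v)
        = (\<Sum>v\<in>Z. ((if v = p then c p else 0) + (if v = q then c q else 0) - g v) *\<^sub>R v)"
      by (intro sum.cong refl arg_cong2[of _ _ _ _ scaleR] cg)
    also have "\<dots> = c p *\<^sub>R p + c q *\<^sub>R q - (\<Sum>v\<in>Z. g v *\<^sub>R v)"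
      unfolding scaleR_diff_left scaleR_add_left sum_subtractf sum.distrib scale
      using finZ pqZ by simp
    finally show "(\<Sum>v\<in>V. g v *\<^sub>R v) = c p *\<^sub>R p + c q *\<^sub>R q"
      using c(2) gV(2) by simp
  qed
  have "sum f V = c p + c q"
    unfolding f_def sum.distrib using finite_V pqV lu by simp
  moreover have "(\<Sum>v\<in>V. f v *\<^sub>R v) = (c p - m) *\<^sub>R p + (c q - m) *\<^sub>R q + (m *\<^sub>R l + m *\<^sub>R u)"
    unfolding f_def scaleR_add_left sum.distrib scale using finite_V pqV lu by (simp add: add.assoc)
  moreover have "m *\<^sub>R l + m *\<^sub>R u = m *\<^sub>R p + m *\<^sub>R q"
    using parallelogram[OF pqV] by (simp add: l_def u_def scaleR_add_right[symmetric])
  ultimately have f_sum: "sum f V = c p + c q" "(\<Sum>v\<in>V. f v *\<^sub>R v) = c p *\<^sub>R p + c q *\<^sub>R q"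
    by (simp_all add: scaleR_diff_left)
  have "f = g"
    by (rule unique_weightsD[OF unique_weights_chains wf wg]) (simp_all add: f_sum g_sum)
  then have "g l = m" "g u = m" and g_zero: "\<And>v. v \<notin> {p, q, l, u} \<Longrightarrow> g v = 0"
    using f_vals f_zero by auto
  then have luY: "l \<in> Y" "u \<in> Y" using m(1) by (auto simp: g_def split: if_splits)
  have "Y \<subseteq> {l, u}"
  proof
    fix v assume v: "v \<in> Y"
    then have "g v \<noteq> 0" "v \<noteq> p" "v \<noteq> q" using pqZ by (auto simp: g_def Y)
    then show "v \<in> {l, u}" using g_zero by blast
  qed
  then have Y_eq: "Y = {l, u}" using luY by blast
  \<comment> \<open>If some element of \<open>Z\<close> had coefficient 0, the others would form a
    smaller dependent set.\<close>
  have "Z = X \<union> Y"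
  proof (rule ccontr)
    assume "Z \<noteq> X \<union> Y"
    then have "X \<union> Y \<subset> Z" using X Y by blast
    moreover have "affine_dependent (X \<union> Y)"
    proof -
      have "sum c (X \<union> Y) = sum c Z" "(\<Sum>z\<in>X \<union> Y. c z *\<^sub>R z) = (\<Sum>z\<in>Z. c z *\<^sub>R z)"
        using finZ by (intro sum.mono_neutral_left; force simp: X Y)+
      moreover have "finite (X \<union> Y)" using X_eq Y_eq by simp
      moreover have "\<exists>v\<in>X \<union> Y. c v \<noteq> 0" using p pqZ(3) by (intro bexI[of _ p]) auto
      ultimately show ?thesis
        using c(1,2) by (subst affine_dependent_explicit_finite) (auto intro!: exI[of _ c])
    qed
    ultimately show False using min by blast
  qed
  then show thesis using that[OF pqV inc X_eq] Y_eq by (simp add: l_def u_def)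
qed

text \<open>\<open>circuit_signs\<close> allows either sign class in the first place, so one
  orientation covers all flips. Circuit and common link are both determined by the parallelogram,
  and with them the faces of \<open>T'\<close>.\<close>

lemma differ_by_flip_square:
  assumes "differ_by_flip P T T'"
  obtains M a b where "square A r M a b" "faces T' = square.flip_complex A r M a b"
proof -
  obtain Z X Y K where Z: "Z \<subseteq> vertices P" "circuit Z" "circuit_signs Z X Y"
      "faces (circuit_triangulation Z X) \<subseteq> chains"
    and lk: "\<And>S. S \<in> circuit_triangulation Z X \<Longrightarrow> link chains S = K"
    and T': "faces T' = (chains - join (faces (circuit_triangulation Z X)) K)
                  \<union> join (faces (circuit_triangulation Z Y)) K"
    using assms unfolding differ_by_flip_def faces_canonical by blast
  obtain p q where pq: "p \<in> V" "q \<in> V" "\<not> comparable p q" "X = {p, q}"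
    "Y = {indicator_vector (Poly_Mapping.keys p \<inter> Poly_Mapping.keys q),
          indicator_vector (Poly_Mapping.keys p \<union> Poly_Mapping.keys q)}" "Z = X \<union> Y"
    using circuit_square[OF Z] by blast
  define l where "l = (indicator_vector (Poly_Mapping.keys p \<inter> Poly_Mapping.keys q) :: 'a \<Rightarrow>\<^sub>0 real)"
  define u where "u = (indicator_vector (Poly_Mapping.keys p \<union> Poly_Mapping.keys q) :: 'a \<Rightarrow>\<^sub>0 real)"
  have lu: "l \<in> V" "u \<in> V"
    unfolding l_def u_def using pq by (simp_all add: indicator_in_V Int_filter Un_filter keys_V)
  have keys: "Poly_Mapping.keys l = Poly_Mapping.keys p \<inter> Poly_Mapping.keys q"
    "Poly_Mapping.keys u = Poly_Mapping.keys p \<union> Poly_Mapping.keys q"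
    unfolding l_def u_def by (simp_all add: keys_indicator_vector)
  have neq: "l \<noteq> p" "l \<noteq> q" "u \<noteq> p" "u \<noteq> q" "l \<noteq> u" "p \<noteq> q" using keys pq(3) by auto
  have Z_eq: "Z = {p, q, l, u}" using pq(4-6) by (auto simp: l_def u_def)
  have "Z - {p} = {q, l, u}" "Z - {q} = {p, l, u}" using Z_eq neq by auto
  then have ctri: "{q, l, u} \<in> circuit_triangulation Z X" "{p, l, u} \<in> circuit_triangulation Z X"
    unfolding circuit_triangulation_def pq(4) by blast+
  have links: "link chains {p, l, u} = link chains {q, l, u}"
    using lk[OF ctri(1)] lk[OF ctri(2)] by simp
  text \<open>Equality of the links forces \<open>p\<close> and \<open>q\<close> to cover their meet.\<close>
  have cover: "\<exists>a. Poly_Mapping.keys x = insert a (Poly_Mapping.keys l) \<and> a \<notin> Poly_Mapping.keys l"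
    if x: "x \<in> V" "y \<in> V" "\<not> comparable x y" "Poly_Mapping.keys l = Poly_Mapping.keys x \<inter> Poly_Mapping.keys y"
      "Poly_Mapping.keys u = Poly_Mapping.keys x \<union> Poly_Mapping.keys y"
      "link chains {x, l, u} = link chains {y, l, u}" for x y
  proof -
    have "Poly_Mapping.keys l \<subset> Poly_Mapping.keys x" using x(3,4) by blast
    then obtain a where a: "a \<in> Poly_Mapping.keys x - Poly_Mapping.keys l"
      "insert a (Poly_Mapping.keys l) \<in> order_filters A r"
      using filter_extension[OF keys_V[OF lu(1)] keys_V[OF x(1)]] by blast
    define G where "G = insert a (Poly_Mapping.keys l)"
    define v where "v = (indicator_vector G :: 'a \<Rightarrow>\<^sub>0 real)"
    have v: "v \<in> V" "Poly_Mapping.keys v = G"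
      unfolding v_def using a(2) by (simp_all add: G_def indicator_in_V keys_indicator_vector)
    have G: "Poly_Mapping.keys l \<subset> G" "G \<subseteq> Poly_Mapping.keys x"
      using a(1) x(4) by (auto simp: G_def)
    \<comment> \<open>Otherwise \<open>v\<close> lies strictly between \<open>l\<close> and
      \<open>x\<close>, hence in the link of the triangle at \<open>x\<close> and so of the one at
      \<open>y\<close>. But \<open>v\<close> inside \<open>y\<close> would put it inside the
      intersection \<open>l\<close>, and \<open>y\<close> inside \<open>v\<close> would put
      \<open>y\<close> inside \<open>x\<close>.\<close>
    have "G = Poly_Mapping.keys x"
    proof (rule ccontr)
      assume "G \<noteq> Poly_Mapping.keys x"
      then have "v \<notin> {x, l, u}" using v(2) G x(5) by auto
      moreover have "{v} \<union> {x, l, u} \<in> chains" "{v} \<in> chains"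
        unfolding chains_def using v x(1,4,5) lu G by auto
      ultimately have "{v} \<in> link chains {x, l, u}" by (auto simp: link_def)
      then have "{v} \<in> link chains {y, l, u}" by (simp only: x(6))
      then have "{v} \<union> {y, l, u} \<in> chains" by (simp add: link_def)
      then have "comparable v y" by (rule chains_comparable) auto
      then show False using G v(2) x(3,4) by blast
    qed
    then show ?thesis using a(1) by (auto simp: G_def)
  qed
  define M where "M = Poly_Mapping.keys l"
  obtain a where a: "Poly_Mapping.keys p = insert a M" "a \<notin> M"
    using cover[of p q] pq keys links by (auto simp: M_def)
  obtain b where b: "Poly_Mapping.keys q = insert b M" "b \<notin> M"
    using cover[of q p] pq keys links by (auto simp: M_def Int_commute Un_commute)
  have sq: "square A r M a b"
  proof unfold_locales
    show "a \<noteq> b" using pq(3) a b by auto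
    show "a \<notin> M" "b \<notin> M" using a b by auto
    show "M \<in> order_filters A r" "insert a M \<in> order_filters A r" "insert b M \<in> order_filters A r"
      using keys_V[OF lu(1)] keys_V[OF pq(1)] keys_V[OF pq(2)] a b by (simp_all add: M_def)
  qed
  interpret sq: square A r M a b by (rule sq)
  have "l = sq.l" "p = sq.p" "q = sq.q" "u = sq.u"
    using indicator_keys[OF lu(1)] indicator_keys[OF pq(1)] indicator_keys[OF pq(2)] indicator_keys[OF lu(2)]
      keys(2) a(1) b(1) by (simp_all add: M_def insert_commute)
  then have XY: "X = {sq.p, sq.q}" "Y = {sq.l, sq.u}" "Z = {sq.p, sq.q, sq.l, sq.u}"
    using pq(4,5) Z_eq by (simp_all add: l_def u_def)
  have "K = sq.outer"
    using lk[of "{sq.q, sq.l, sq.u}"] sq.link_square[of sq.q] sq.circuit_triangulation_square(1) XY by simp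
  then have "faces T' = sq.flip_complex"
    using T' sq.flip_faces sq.circuit_triangulation_square XY by simp
  then show thesis using that sq by blast
qed

section \<open>Flips correspond bijectively to parallelograms\<close>

lemma squares_square: "square A r M a b \<Longrightarrow> (M, {a, b}) \<in> squares"
  unfolding squares_def square_def square_axioms_def by blast

lemma square_squares:
  assumes "(M, e) \<in> squares"
  obtains a b where "e = {a, b}" "square A r M a b"
  using assms finite_poset_axioms unfolding squares_def square_def square_axioms_def by blast

lemma flips_eq: "{T'. vertex_triangulation P T' \<and> differ_by_flip P T T'} = (\<lambda>(M, e). flipped M e) ` squares"
proof (intro equalityI subsetI)
  fix T' assume "T' \<in> {T'. vertex_triangulation P T' \<and> differ_by_flip P T T'}"
  then have T': "vertex_triangulation P T'" "differ_by_flip P T T'" by auto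
  obtain M a b where sq: "square A r M a b" "faces T' = square.flip_complex A r M a b"
    using differ_by_flip_square[OF T'(2)] by blast
  have "T' = flipped M {a, b}"
    using vertex_triangulation_faces_inject[OF T'(1) square.vertex_triangulation_flipped[OF sq(1)]]
      square.faces_flipped[OF sq(1)] sq(2) by simp
  then show "T' \<in> (\<lambda>(M, e). flipped M e) ` squares"
    using squares_square[OF sq(1)] by force
next
  fix T' assume "T' \<in> (\<lambda>(M, e). flipped M e) ` squares"
  then obtain M e where "T' = flipped M e" "(M, e) \<in> squares" by auto
  then obtain a b where T': "T' = flipped M {a, b}" and sq: "square A r M a b"
    using square_squares by metis
  then show "T' \<in> {T'. vertex_triangulation P T' \<and> differ_by_flip P T T'}"
    unfolding T' using square.vertex_triangulation_flipped[OF sq]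
      square.differ_by_flip_flipped[OF sq square.faces_flipped[OF sq]] by simp
qed

text \<open>The edge \<open>{p, q}\<close> is the only one of the flipped complex with incomparable
  ends. Intersection and union of these two filters give back \<open>M\<close> and
  \<open>e\<close>.\<close>

lemma inj_flipped: "inj_on (\<lambda>(M, e). flipped M e) squares"
proof (rule inj_onI, clarify)
  fix M e M' e'
  assume sq: "(M, e) \<in> squares" "(M', e') \<in> squares" and eq: "flipped M e = flipped M' e'"
  obtain a b where e: "e = {a, b}" and 1: "square A r M a b" using square_squares[OF sq(1)] by blast
  obtain a' b' where e': "e' = {a', b'}" and 2: "square A r M' a' b'" using square_squares[OF sq(2)] by blast
  interpret s1: square A r M a b by (rule 1)
  interpret s2: square A r M' a' b' by (rule 2)
  have "s1.flip_complex = s2.flip_complex"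
    using eq s1.faces_flipped s2.faces_flipped e e' by metis
  moreover have "{s1.p, s1.q} \<union> {} \<in> s1.flip_complex"
    by (rule s1.outer_flip_complex) (auto simp: s1.outer_def chains_def)
  ultimately have "{s1.p, s1.q} \<in> s2.flip_complex" by simp
  then have "{s1.p, s1.q} = {s2.p, s2.q}"
    using s2.flip_complexD[of "{s1.p, s1.q}" s1.p s1.q] s1.incomparable by blast
  then have "Poly_Mapping.keys ` {s1.p, s1.q} = Poly_Mapping.keys ` {s2.p, s2.q}" by simp
  then have "{insert a M, insert b M} = {insert a' M', insert b' M'}" by simp
  then have I: "\<Inter>{insert a M, insert b M} = \<Inter>{insert a' M', insert b' M'}"
    and U: "\<Union>{insert a M, insert b M} = \<Union>{insert a' M', insert b' M'}" by simp_all
  have "M = M'" using I s1.ab s2.ab by auto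
  moreover have "{a, b} = \<Union>{insert a M, insert b M} - M" "{a', b'} = \<Union>{insert a' M', insert b' M'} - M'"
    using s1.ab s2.ab by auto
  ultimately show "M = M' \<and> e = e'" using U e e' by simp
qed

theorem number_of_flips_canonical: "number_of_flips P T = card squares"
  unfolding number_of_flips_def flips_eq by (rule card_image[OF inj_flipped])

end

text \<open>\<open>width\<close> excludes three pairwise incomparable elements. For an incomparable
  pair \<open>a\<close>, \<open>b\<close> every further element is therefore comparable with one of
  them, and it has to be in \<open>M\<close> exactly if it is above one of them; this leaves a
  single choice of \<open>M\<close>.\<close>

theorem number_of_flips_width_two:
  fixes A :: "'a set"
  assumes "finite_poset A r"
    and width: "\<And>a b x. a \<in> A \<Longrightarrow> b \<in> A \<Longrightarrow> a \<noteq> b \<Longrightarrow> (a, b) \<notin> r \<Longrightarrow> (b, a) \<notin> r \<Longrightarrow>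
      x \<in> A \<Longrightarrow> x \<noteq> a \<Longrightarrow> x \<noteq> b \<Longrightarrow> (x, a) \<in> r \<or> (a, x) \<in> r \<or> (x, b) \<in> r \<or> (b, x) \<in> r"
  shows "number_of_flips (order_polytope A r) (canonical_triangulation A r)
    = card {{a, b} | a b. a \<in> A \<and> b \<in> A \<and> a \<noteq> b \<and> (a, b) \<notin> r \<and> (b, a) \<notin> r}"
    (is "_ = card ?E")
proof -
  interpret finite_poset A r by fact
  have tr: "(x, z) \<in> r" if "(x, y) \<in> r" "(y, z) \<in> r" for x y z
    using trans_r that by (rule transD)
  have inj: "inj_on snd squares"
  proof (rule inj_onI, clarsimp)
    fix M M' e assume "(M, e) \<in> squares" "(M', e) \<in> squares"
    then obtain a b a' b' where e: "e = {a, b}" "e = {a', b'}" and "square A r M a b" "square A r M' a' b'"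
      by (metis square_squares)
    then interpret s1: square A r M a b + s2: square A r M' a' b' by simp_all
    \<comment> \<open>An element of \<open>N1\<close> is not below \<open>c\<close> or
      \<open>d\<close>, since the filter \<open>N1\<close> would then contain them. So it is above
      one of them and belongs to \<open>N2\<close> extended by that one.\<close>
    have "N1 \<subseteq> N2" if N: "N1 \<in> order_filters A r" "N2 \<in> order_filters A r"
        "insert c N1 \<in> order_filters A r" "insert d N1 \<in> order_filters A r" 
        "insert c N2 \<in> order_filters A r" "insert d N2 \<in> order_filters A r"
        and cd: "c \<noteq> d" "c \<notin> N1" "d \<notin> N1" "c \<notin> N2" "d \<notin> N2" for N1 N2 c d
    proof
      fix x assume x: "x \<in> N1"
      have A: "x \<in> A" "c \<in> A" "d \<in> A" using x N by (auto simp: order_filters_def)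
      have "(c, d) \<notin> r" "(d, c) \<notin> r" using N(3,4) cd A by (auto simp: order_filters_def)
      then have "(x, c) \<in> r \<or> (c, x) \<in> r \<or> (x, d) \<in> r \<or> (d, x) \<in> r"
        using width[OF A(2,3) cd(1) _ _ A(1)] x cd by blast
      moreover have "(x, c) \<notin> r" "(x, d) \<notin> r" using N(1) x A cd by (auto simp: order_filters_def)
      ultimately have "x \<in> insert c N2 \<or> x \<in> insert d N2" using N(5,6) A(1) by (auto simp: order_filters_def)
      then show "x \<in> N2" using x cd by auto
    qed
    note sub = this
    have ab': "{a', b'} = {a, b}" using e by simp
    have "insert a M' \<in> order_filters A r" "insert b M' \<in> order_filters A r" "a \<notin> M'" "b \<notin> M'"
      using ab' s2.aM s2.bM s2.ab by (auto simp: doubleton_eq_iff)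
    then show "M = M'"
      using sub[of M M' a b] sub[of M' M a b] s1.M s2.M s1.aM s1.bM s1.ab by blast
  qed
  have "snd ` squares = ?E"
  proof (intro equalityI subsetI)
    fix e assume "e \<in> snd ` squares"
    then obtain M where "(M, e) \<in> squares" by auto
    then obtain a b where e: "e = {a, b}" and "square A r M a b" using square_squares by blast
    then interpret square A r M a b by simp
    have "a \<in> A" "b \<in> A" "(a, b) \<notin> r" "(b, a) \<notin> r"
      using aM bM ab by (auto simp: order_filters_def)
    then show "e \<in> ?E" using e ab by blast
  next
    fix e assume "e \<in> ?E"
    then obtain a b where e: "e = {a, b}" and ab: "a \<in> A" "b \<in> A" "a \<noteq> b" "(a, b) \<notin> r" "(b, a) \<notin> r"
      by blast
    define M where "M = {x\<in>A. x \<noteq> a \<and> x \<noteq> b \<and> ((a, x) \<in> r \<or> (b, x) \<in> r)}"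
    \<comment> \<open>\<open>M\<close>, either one-element extension and both together are filters
      for the same reason: everything strictly above an element of \<open>N\<close> is above
      \<open>a\<close> or \<open>b\<close> and different from both.\<close>
    have ext: "N \<in> order_filters A r" if "M \<subseteq> N" "N \<subseteq> M \<union> {a, b}" for N
      unfolding order_filters_def
    proof (intro CollectI conjI ballI impI)
      show "N \<subseteq> A" using that ab by (auto simp: M_def)
      fix x y assume xy: "x \<in> N" "y \<in> A" "(x, y) \<in> r"
      show "y \<in> N"
      proof (cases "y = x")
        case False
        have "(a, y) \<in> r \<or> (b, y) \<in> r"
          using xy that tr by (auto simp: M_def)
        moreover have "y \<noteq> a" "y \<noteq> b"
          using xy that ab False antisym_r tr[of a x b] tr[of b x a]
          by (auto simp: M_def antisym_def)
        ultimately have "y \<in> M" using xy by (simp add: M_def)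
        then show ?thesis using that by blast
      qed (use xy in simp)
    qed
    have "square A r M a b"
      by unfold_locales (use ab in \<open>auto intro!: ext simp: M_def\<close>)
    then show "e \<in> snd ` squares" using squares_square e by force
  qed
  then show ?thesis
    using number_of_flips_canonical card_image[OF inj] by simp
qed

section \<open>The posets of snake words\<close>

definition turn :: "letter list \<Rightarrow> nat \<Rightarrow> bool" where
  "turn w n \<longleftrightarrow> (if n = 1 then w ! 0 = L else w ! (n - 2) \<noteq> w ! (n - 1))"

text \<open>The value 0 means that there has been no turn. Between turns the even labels form a
  descending chain, so the last turn is all that the up-set of \<open>2 * n + 2\<close> remembers of
  the word.\<close>

fun last_turn :: "letter list \<Rightarrow> nat \<Rightarrow> nat" where
  "last_turn w 0 = 0"
| "last_turn w (Suc n) = (if turn w (Suc n) then Suc n else last_turn w n)"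

lemma last_turn_le: "last_turn w n \<le> n"
  by (induction n) auto

lemma snake_covers_iff:
  "(x, y) \<in> snake_covers w n \<longleftrightarrow>
    (x = 1 \<or> x = 2) \<and> y = 0 \<or>
    (\<exists>i\<le>n. x = 2 * i + 3 \<and> (y = 2 * i + 1 \<or> y = 2 * i + 2)) \<or>
    (\<exists>i. 1 \<le> i \<and> i \<le> n \<and> x = 2 * i + 2 \<and> y = (if turn w i then 2 * i - 1 else 2 * i))"
proof (induction n)
  case 0
  show ?case by auto
next
  case (Suc n)
  have ex_le: "(\<exists>i\<le>Suc n. Q i) \<longleftrightarrow> (\<exists>i\<le>n. Q i) \<or> Q (Suc n)"
    and ex_ge: "(\<exists>i. 1 \<le> i \<and> i \<le> Suc n \<and> Q i) \<longleftrightarrow> (\<exists>i. 1 \<le> i \<and> i \<le> n \<and> Q i) \<or> Q (Suc n)" for Q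
    by (auto simp: le_Suc_eq)
  have "(x, y) \<in> snake_covers w (Suc n) \<longleftrightarrow> (x, y) \<in> snake_covers w n \<or>
      x = 2 * Suc n + 3 \<and> (y = 2 * Suc n + 1 \<or> y = 2 * Suc n + 2) \<or>
      x = 2 * Suc n + 2 \<and> y = (if turn w (Suc n) then 2 * Suc n - 1 else 2 * Suc n)"
    by (auto simp: Let_def turn_def)
  then show ?case unfolding Suc.IH ex_le ex_ge by argo
qed

text \<open>Labels decrease going up, so the reversed order of the naturals is a linear extension of
  \<open>P(w)\<close>. Antisymmetry and the maximality of 0 come from this.\<close>

lemma snake_covers_decreasing: "(x, y) \<in> snake_covers w n \<Longrightarrow> y < x"
  unfolding snake_covers_iff by (auto split: if_splits)

lemma snake_rtrancl_le: "(x, y) \<in> (snake_covers w n)\<^sup>* \<Longrightarrow> y \<le> x"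
  by (induction rule: rtrancl_induct) (auto dest: snake_covers_decreasing)

lemma snake_rtrancl_unfold:
  "(x, y) \<in> (snake_covers w n)\<^sup>* \<longleftrightarrow> x = y \<or> (\<exists>z. (x, z) \<in> snake_covers w n \<and> (z, y) \<in> (snake_covers w n)\<^sup>*)"
proof
  assume "(x, y) \<in> (snake_covers w n)\<^sup>*"
  then show "x = y \<or> (\<exists>z. (x, z) \<in> snake_covers w n \<and> (z, y) \<in> (snake_covers w n)\<^sup>*)"
    by (cases rule: converse_rtranclE) blast+
next
  assume "x = y \<or> (\<exists>z. (x, z) \<in> snake_covers w n \<and> (z, y) \<in> (snake_covers w n)\<^sup>*)"
  then show "(x, y) \<in> (snake_covers w n)\<^sup>*"
    by (elim disjE exE conjE) (simp, rule converse_rtrancl_into_rtrancl)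
qed

lemma snake_rtrancl_single:
  assumes "\<And>z. (x, z) \<in> snake_covers w n \<longleftrightarrow> z = a"
  shows "(x, y) \<in> (snake_covers w n)\<^sup>* \<longleftrightarrow> y = x \<or> (a, y) \<in> (snake_covers w n)\<^sup>*"
  by (subst snake_rtrancl_unfold) (auto simp: assms)

lemma snake_covers_one_two: "(1, z) \<in> snake_covers w n \<longleftrightarrow> z = 0" "(2, z) \<in> snake_covers w n \<longleftrightarrow> z = 0"
  by (auto simp: snake_covers_iff)

lemma snake_covers_odd:
  assumes "i \<le> n"
  shows "(2 * i + 3, z) \<in> snake_covers w n \<longleftrightarrow> z = 2 * i + 1 \<or> z = 2 * i + 2"
proof -
  have "2 * i + 3 \<noteq> 2 * j + 2" for j by presburger
  then show ?thesis using assms by (auto simp: snake_covers_iff)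
qed

lemma snake_covers_even:
  assumes "1 \<le> i" "i \<le> n"
  shows "(2 * i + 2, z) \<in> snake_covers w n \<longleftrightarrow> z = (if turn w i then 2 * i - 1 else 2 * i)"
proof -
  have "2 * i + 2 \<noteq> 2 * j + 3" for j by presburger
  then show ?thesis using assms by (auto simp: snake_covers_iff)
qed

text \<open>
  With last turn \<open>t \<le> i\<close>, the element \<open>2 * i + 2\<close> avoids only \<open>2 * t\<close> (which is \<open>1\<close> for \<open>t = 0\<close>) among
  the smaller numbers in \<open>Q\<close>; the element \<open>0\<close> is listed separately for the case \<open>t = 0\<close>.
\<close>
definition snake_up :: "letter list \<Rightarrow> nat \<Rightarrow> nat set" where
  "snake_up w i = {0} \<union> {..<2 * last_turn w i} \<union>
    {y. even y \<and> 2 * last_turn w i + 2 \<le> y \<and> y \<le> 2 * i + 2}"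

text \<open>Odd labels from 3 on are pinch points: everything introduced so far lies above
  \<open>2 * i + 3\<close>. A turn attaches \<open>2 * i + 2\<close> to the odd label
  \<open>2 * i - 1\<close>, whose up-set is again everything up to that label; without a turn
  \<open>2 * i + 2\<close> inherits the up-set of \<open>2 * i\<close>.\<close>

lemma snake_rtrancl:
  assumes "i \<le> n"
  shows "((2 * i + 2, y) \<in> (snake_covers w n)\<^sup>* \<longleftrightarrow> y \<in> snake_up w i) \<and>
    ((2 * i + 3, y) \<in> (snake_covers w n)\<^sup>* \<longleftrightarrow> y \<le> 2 * i + 3)"
  using assms
proof (induction i arbitrary: y rule: less_induct)
  case (less i)
  let ?r = "snake_covers w n"
  have zero: "(0, y) \<in> ?r\<^sup>* \<longleftrightarrow> y = 0" for y
    using snake_rtrancl_le[of 0 y] by auto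
  have one: "(1, y) \<in> ?r\<^sup>* \<longleftrightarrow> y \<le> 1" for y
    unfolding snake_rtrancl_single[OF snake_covers_one_two(1)] zero by arith
  \<comment> \<open>\<open>2 * i + 1\<close> is the odd label of the previous step, or the element 1
    when \<open>i = 0\<close>.\<close>
  have odd: "(2 * i + 1, y) \<in> ?r\<^sup>* \<longleftrightarrow> y \<le> 2 * i + 1" for y
  proof (cases i)
    case (Suc j)
    then show ?thesis using less.IH[of j y] less.prems by (simp add: numeral_3_eq_3)
  qed (use one in simp)
  have even: "(2 * i + 2, y) \<in> ?r\<^sup>* \<longleftrightarrow> y \<in> snake_up w i" for y
  proof (cases i)
    case 0
    have "(2, y) \<in> ?r\<^sup>* \<longleftrightarrow> y = 2 \<or> y = 0"
      unfolding snake_rtrancl_single[OF snake_covers_one_two(2)] zero by (rule refl)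
    moreover have "y \<in> snake_up w 0 \<longleftrightarrow> y = 2 \<or> y = 0" by (auto simp: snake_up_def)
    ultimately show ?thesis using 0 by (simp add: numeral_2_eq_2)
  next
    case (Suc j)
    have "1 \<le> i" using Suc by simp
    note step = snake_rtrancl_single[OF snake_covers_even[OF this less.prems], of y w]
    show ?thesis
    proof (cases "turn w i")
      case True
      have "(2 * i - 1, y) \<in> ?r\<^sup>* \<longleftrightarrow> y \<le> 2 * i - 1"
      proof (cases j)
        case 0
        then show ?thesis using one Suc by simp
      next
        case (Suc k)
        then show ?thesis using less.IH[of k y] less.prems \<open>i = Suc j\<close> by (simp add: numeral_3_eq_3)
      qed
      then have "(2 * i + 2, y) \<in> ?r\<^sup>* \<longleftrightarrow> y = 2 * i + 2 \<or> y \<le> 2 * i - 1"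
        using step True by simp
      moreover have "last_turn w i = i" using True Suc by simp
      then have "y \<in> snake_up w i \<longleftrightarrow> y = 2 * i + 2 \<or> y \<le> 2 * i - 1"
        using Suc by (auto simp: snake_up_def)
      ultimately show ?thesis by simp
    next
      case False
      have "(2 * i, y) \<in> ?r\<^sup>* \<longleftrightarrow> y \<in> snake_up w j"
        using less.IH[of j y] less.prems Suc by simp
      then have "(2 * i + 2, y) \<in> ?r\<^sup>* \<longleftrightarrow> y = 2 * i + 2 \<or> y \<in> snake_up w j"
        using step False by simp
      moreover have t: "last_turn w i = last_turn w j" using False Suc by simp
      have "y \<in> snake_up w i \<longleftrightarrow> y = 2 * i + 2 \<or> y \<in> snake_up w j"
      proof -
        have "even y \<and> y \<le> 2 * i + 2 \<longleftrightarrow> y = 2 * i + 2 \<or> even y \<and> y \<le> 2 * j + 2"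
          unfolding Suc by presburger
        moreover have "2 * last_turn w j + 2 \<le> 2 * i + 2" using last_turn_le[of w j] Suc by simp
        ultimately show ?thesis unfolding snake_up_def t by blast
      qed
      ultimately show ?thesis by simp
    qed
  qed
  have "(2 * i + 3, y) \<in> ?r\<^sup>* \<longleftrightarrow> y = 2 * i + 3 \<or> y \<le> 2 * i + 1 \<or> y \<in> snake_up w i"
    unfolding odd[symmetric] even[symmetric]
    by (subst snake_rtrancl_unfold) (auto simp: snake_covers_odd[OF less.prems])
  moreover have "y \<in> snake_up w i \<Longrightarrow> y \<le> 2 * i + 2" "2 * i + 2 \<in> snake_up w i"
    using last_turn_le[of w i] by (auto simp: snake_up_def)
  ultimately have "(2 * i + 3, y) \<in> ?r\<^sup>* \<longleftrightarrow> y \<le> 2 * i + 3"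
    by (auto simp: le_less numeral_3_eq_3 less_Suc_eq)
  with even show ?case by simp
qed

section \<open>Up-sets and generating steps in \<open>P(w)\<close>\<close>

context
  fixes w :: "letter list"
begin

private abbreviation "n \<equiv> length w"
private abbreviation "H \<equiv> hat_carrier (snake_carrier w)"
private abbreviation "hle \<equiv> hat_order (snake_carrier w) (snake_order w)"

lemma snake_order_up:
  assumes "i \<le> n"
  shows "(2 * i + 2, y) \<in> snake_order w \<longleftrightarrow> y \<in> snake_up w i"
    and "(2 * i + 3, y) \<in> snake_order w \<longleftrightarrow> y \<le> 2 * i + 3"
proof -
  have "y \<in> snake_carrier w" if "y \<in> snake_up w i"
    using that assms last_turn_le[of w i] by (auto simp: snake_up_def snake_carrier_def)
  moreover have "y \<in> snake_carrier w" if "y \<le> 2 * i + 3"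
    using that assms by (simp add: snake_carrier_def)
  moreover have "2 * i + 2 \<in> snake_carrier w" "2 * i + 3 \<in> snake_carrier w"
    using assms by (simp_all add: snake_carrier_def)
  ultimately show "(2 * i + 2, y) \<in> snake_order w \<longleftrightarrow> y \<in> snake_up w i"
    and "(2 * i + 3, y) \<in> snake_order w \<longleftrightarrow> y \<le> 2 * i + 3"
    using snake_rtrancl[OF assms, of y w] unfolding snake_order_def by blast+
qed

lemma snake_order_one: "(1, y) \<in> snake_order w \<longleftrightarrow> y \<le> 1"
proof -
  have "(0, z) \<in> (snake_covers w n)\<^sup>* \<longleftrightarrow> z = 0" for z
    using snake_rtrancl_le[of 0 z] by auto
  then have "(1, y) \<in> (snake_covers w n)\<^sup>* \<longleftrightarrow> y \<le> 1"
    unfolding snake_rtrancl_single[OF snake_covers_one_two(1)] by arith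
  then show ?thesis
    by (auto simp: snake_order_def snake_carrier_def)
qed

lemma snake_order_le: "(x, y) \<in> snake_order w \<Longrightarrow> y \<le> x"
  by (auto simp: snake_order_def dest: snake_rtrancl_le)

lemma snake_order_carrier: "(x, y) \<in> snake_order w \<Longrightarrow> x \<in> snake_carrier w \<and> y \<in> snake_carrier w"
  by (auto simp: snake_order_def)

lemma snake_order_refl: "x \<in> snake_carrier w \<Longrightarrow> (x, x) \<in> snake_order w"
  by (auto simp: snake_order_def)

lemma snake_order_step:
  assumes "(x, y) \<in> snake_order w" "x \<noteq> y"
  obtains z where "(x, z) \<in> snake_covers w n" "(z, y) \<in> snake_order w"
proof -
  obtain z where z: "(x, z) \<in> snake_covers w n" "(z, y) \<in> (snake_covers w n)\<^sup>*"
    using assms snake_rtrancl_unfold[of x y w n] by (auto simp: snake_order_def)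
  have "z \<in> snake_carrier w"
    using snake_covers_decreasing[OF z(1)] assms(1) by (auto simp: snake_order_def snake_carrier_def)
  then show thesis using that z assms(1) by (auto simp: snake_order_def)
qed

lemma snake_covers_order:
  assumes "(x, y) \<in> snake_covers w n"
  shows "(x, y) \<in> snake_order w" "x \<noteq> y" "x \<in> snake_carrier w" "y \<in> snake_carrier w"
proof -
  show x: "x \<in> snake_carrier w" using assms by (auto simp: snake_covers_iff snake_carrier_def)
  show "x \<noteq> y" and y: "y \<in> snake_carrier w"
    using x snake_covers_decreasing[OF assms] by (auto simp: snake_carrier_def)
  show "(x, y) \<in> snake_order w" using assms x y by (auto simp: snake_order_def)
qed

section \<open>The bounded extension and its cover relation\<close>

lemma hle_Elem: "(Elem x, Elem y) \<in> hle \<longleftrightarrow> (x, y) \<in> snake_order w"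
  by (auto simp: hat_order_def)

lemma trans_snake_order: "trans (snake_order w)"
  unfolding snake_order_def by (intro trans_Restr trans_rtrancl)

lemma trans_hle: "trans hle"
proof (rule transI)
  fix x y z assume xyz: "(x, y) \<in> hle" "(y, z) \<in> hle"
  have carrier: "Elem u \<in> H" if "(u, v) \<in> snake_order w \<or> (v, u) \<in> snake_order w" for u v
    using that snake_order_carrier by (auto simp: hat_carrier_def)
  show "(x, z) \<in> hle"
  proof (cases "\<exists>a b c. x = Elem a \<and> y = Elem b \<and> z = Elem c")
    case True
    then show ?thesis using xyz hle_Elem trans_snake_order by (auto dest: transD)
  next
    case False
    then show ?thesis
      using xyz carrier by (cases x; cases z) (auto simp: hat_order_def hat_carrier_def)
  qed
qed

lemma antisym_hle: "antisym hle"
proof (rule antisymI)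
  fix x y assume "(x, y) \<in> hle" "(y, x) \<in> hle"
  then show "x = y"
    by (cases x; cases y) (auto simp: hat_order_def dest!: snake_order_le)
qed

text \<open>Anything in \<open>P(w)\<close> strictly above \<open>x\<close> is reached through a
  first generating step, so only generators can be covers, and a generator fails to be one exactly
  if another generator from \<open>x\<close> lies below its target. Generators need only be tested
  against each other.\<close>

lemma covers_Elem:
  assumes x: "x \<in> snake_carrier w" "x \<noteq> 0"
  shows "is_covered_by H hle (Elem x) y \<longleftrightarrow>
    (\<exists>z. y = Elem z \<and> (x, z) \<in> snake_covers w n \<and>
      (\<forall>z'. (x, z') \<in> snake_covers w n \<and> (z', z) \<in> snake_order w \<longrightarrow> z' = z))"
proof
  assume cov: "is_covered_by H hle (Elem x) y"
  have H: "Elem u \<in> H" if "u \<in> snake_carrier w" for u using that by (simp add: hat_carrier_def)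
  have no: "u = Elem x \<or> u = y" if "u \<in> H" "(Elem x, u) \<in> hle" "(u, y) \<in> hle" for u
    using cov that by (auto simp: is_covered_by_def)
  have y: "y \<noteq> Elem x" "(Elem x, y) \<in> hle" using cov by (auto simp: is_covered_by_def)
  have zero: "0 \<in> snake_carrier w" by (simp add: snake_carrier_def)
  show "\<exists>z. y = Elem z \<and> (x, z) \<in> snake_covers w n \<and>
      (\<forall>z'. (x, z') \<in> snake_covers w n \<and> (z', z) \<in> snake_order w \<longrightarrow> z' = z)"
  proof (cases y)
    case (Elem z)
    then have xz: "(x, z) \<in> snake_order w" "x \<noteq> z" using y hle_Elem by auto
    obtain z1 where z1: "(x, z1) \<in> snake_covers w n" "(z1, z) \<in> snake_order w"
      using snake_order_step[OF xz] by blast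
    have "z' = z" if "(x, z') \<in> snake_covers w n" "(z', z) \<in> snake_order w" for z'
      using no[of "Elem z'"] that snake_covers_order[OF that(1)] H hle_Elem Elem by auto
    then show ?thesis using z1 Elem by blast
  next
    case One_hat
    \<comment> \<open>The maximum 0 of \<open>P(w)\<close> lies strictly between
      \<open>Elem x\<close> and the new maximum, so \<open>One_hat\<close> cannot cover
      \<open>Elem x\<close>.\<close>
    have "(x, 0) \<in> snake_order w"
    proof -
      consider i where "x = 2 * i + 2" "i \<le> n" | i where "x = 2 * i + 3" "i \<le> n" | "x = 1"
      proof -
        assume *: "\<And>i. x = 2 * i + 2 \<Longrightarrow> i \<le> n \<Longrightarrow> thesis" "\<And>i. x = 2 * i + 3 \<Longrightarrow> i \<le> n \<Longrightarrow> thesis" "x = 1 \<Longrightarrow> thesis"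
        have "x = 1 \<or> x = 2 * ((x - 2) div 2) + 2 \<or> x = 2 * ((x - 3) div 2) + 3" using x(2) by presburger
        then show thesis using * x(1) by (auto simp: snake_carrier_def)
      qed
      then show ?thesis
        using snake_order_up snake_order_one by cases (auto simp: snake_up_def)
    qed
    then have "Elem 0 = Elem x \<or> Elem 0 = y"
      using no[of "Elem 0"] H[OF zero] hle_Elem One_hat by (simp add: hat_order_def)
    then show ?thesis using x One_hat by simp
  next
    case Zero_hat
    then show ?thesis using y by (simp add: hat_order_def)
  qed
next
  assume "\<exists>z. y = Elem z \<and> (x, z) \<in> snake_covers w n \<and>
      (\<forall>z'. (x, z') \<in> snake_covers w n \<and> (z', z) \<in> snake_order w \<longrightarrow> z' = z)"
  then obtain z where z: "y = Elem z" "(x, z) \<in> snake_covers w n"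
    "\<And>z'. (x, z') \<in> snake_covers w n \<Longrightarrow> (z', z) \<in> snake_order w \<Longrightarrow> z' = z"
    by blast
  note xz = snake_covers_order[OF z(2)]
  have "v = Elem x \<or> v = Elem z" if v: "(Elem x, v) \<in> hle" "(v, Elem z) \<in> hle" for v
  proof (cases v)
    case (Elem u)
    then have u: "(x, u) \<in> snake_order w" "(u, z) \<in> snake_order w" using v hle_Elem by auto
    show ?thesis
    proof (cases "u = x")
      case False
      then obtain z1 where z1: "(x, z1) \<in> snake_covers w n" "(z1, u) \<in> snake_order w"
        using snake_order_step[OF u(1)] by metis
      then have "(z1, z) \<in> snake_order w" using u(2) trans_snake_order by (meson transD)
      then have "z1 = z" using z(3) z1(1) by blast
      then have "u = z" using z1(2) u(2) snake_order_le by (meson order_antisym)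
      then show ?thesis using Elem by simp
    qed (use Elem in simp)
  qed (use v in \<open>auto simp: hat_order_def\<close>)
  then show "is_covered_by H hle (Elem x) y"
    using xz z(1) hle_Elem by (auto simp: is_covered_by_def hat_carrier_def)
qed

section \<open>The meet-irreducible elements\<close>

lemma Q_carrierI:
  assumes "v \<in> H" "v \<noteq> One_hat" "\<And>y. is_covered_by H hle v y \<longleftrightarrow> y = z"
  shows "v \<in> Q_carrier w"
  unfolding Q_carrier_def by (intro CollectI conjI assms(1,2) ex1I[of _ z]) (simp_all only: assms(3))

text \<open>Odd labels from 3 on have two covers and drop out, while 1 and the positive even labels
  have a single generating step upwards. \<open>Elem 0\<close> is covered only by the new maximum,
  and \<open>Zero_hat\<close> only by the old minimum \<open>2 * n + 3\<close>.\<close>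

lemma Q_carrier_eq: "Q_carrier w = {Zero_hat} \<union> Elem ` {x. x \<le> 2 * n + 3 \<and> (even x \<or> x = 1)}"
proof -
  have bot: "Zero_hat \<in> Q_carrier w"
  proof -
    have min: "(2 * n + 3, y) \<in> snake_order w \<longleftrightarrow> y \<in> snake_carrier w" for y
      using snake_order_up(2)[of n y] by (simp add: snake_carrier_def)
    have bot: "2 * n + 3 \<in> snake_carrier w" by (simp add: snake_carrier_def)
    have "is_covered_by H hle Zero_hat y \<longleftrightarrow> y = Elem (2 * n + 3)" for y
    proof
      assume cov: "is_covered_by H hle Zero_hat y"
      then have "y \<noteq> Zero_hat" "y \<in> H" by (auto simp: is_covered_by_def)
      then have "(Elem (2 * n + 3), y) \<in> hle"
        using min bot by (cases y) (auto simp: hat_order_def hat_carrier_def)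
      then show "y = Elem (2 * n + 3)"
        using cov bot by (auto simp: is_covered_by_def hat_carrier_def hat_order_def)
    next
      assume y: "y = Elem (2 * n + 3)"
      have "v = Zero_hat \<or> v = y" if "(v, y) \<in> hle" for v
        using that y snake_order_le snake_order_carrier
        by (cases v) (force simp: hat_order_def snake_carrier_def)+
      then show "is_covered_by H hle Zero_hat y"
        using bot y by (auto simp: is_covered_by_def hat_carrier_def hat_order_def)
    qed
    then show ?thesis by (intro Q_carrierI) (simp_all add: hat_carrier_def)
  qed
  have top: "Elem 0 \<in> Q_carrier w"
  proof -
    have "(Elem 0, v) \<in> hle \<longleftrightarrow> v = Elem 0 \<or> v = One_hat" for v
      using snake_order_le[of 0] snake_order_refl[of 0]
      by (cases v) (auto simp: hat_order_def hat_carrier_def snake_carrier_def)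
    then have "is_covered_by H hle (Elem 0) y \<longleftrightarrow> y = One_hat" for y
      by (auto simp: is_covered_by_def hat_carrier_def snake_carrier_def)
    then show ?thesis by (intro Q_carrierI) (simp_all add: hat_carrier_def snake_carrier_def)
  qed
  have single: "Elem x \<in> Q_carrier w"
    if x: "x \<in> snake_carrier w" "x \<noteq> 0" and z: "\<And>z'. (x, z') \<in> snake_covers w n \<longleftrightarrow> z' = z" for x z
  proof -
    have "is_covered_by H hle (Elem x) y \<longleftrightarrow> y = Elem z" for y
      unfolding covers_Elem[OF x] z by blast
    then show ?thesis using x by (intro Q_carrierI) (simp_all add: hat_carrier_def)
  qed
  \<comment> \<open>The targets \<open>2 * i + 1\<close> and \<open>2 * i + 2\<close> are
    incomparable: one direction contradicts the order of the labels, the other the shape of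
    \<open>snake_up w i\<close>, whose odd members are all smaller than
    \<open>2 * last_turn w i\<close>.\<close>
  have odd: "Elem (2 * i + 3) \<notin> Q_carrier w" if "i \<le> n" for i
  proof -
    have x: "2 * i + 3 \<in> snake_carrier w" "2 * i + 3 \<noteq> 0" using that by (auto simp: snake_carrier_def)
    note cov = snake_covers_odd[OF that]
    have "(2 * i + 1, 2 * i + 2) \<notin> snake_order w" using snake_order_le by fastforce
    moreover have "2 * i + 1 \<notin> snake_up w i" using last_turn_le[of w i] by (auto simp: snake_up_def)
    then have "(2 * i + 2, 2 * i + 1) \<notin> snake_order w" using snake_order_up(1)[OF that] by blast
    ultimately have "is_covered_by H hle (Elem (2 * i + 3)) (Elem (2 * i + 1))"
      "is_covered_by H hle (Elem (2 * i + 3)) (Elem (2 * i + 2))"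
      unfolding covers_Elem[OF x] cov by auto
    moreover have "Elem (2 * i + 1) \<noteq> Elem (2 * i + 2)" by simp
    ultimately show ?thesis unfolding Q_carrier_def by blast
  qed
  show ?thesis
  proof (intro equalityI subsetI)
    fix v assume v: "v \<in> Q_carrier w"
    show "v \<in> {Zero_hat} \<union> Elem ` {x. x \<le> 2 * n + 3 \<and> (even x \<or> x = 1)}"
    proof (cases v)
      case (Elem x)
      then have x: "x \<le> 2 * n + 3" using v by (auto simp: Q_carrier_def hat_carrier_def snake_carrier_def)
      have "even x \<or> x = 1"
      proof (rule ccontr)
        assume "\<not> ?thesis"
        then have "x = 2 * ((x - 3) div 2) + 3" by presburger
        moreover have "(x - 3) div 2 \<le> n" using x by linarith
        ultimately show False using odd v Elem by metis
      qed
      then show ?thesis using x Elem by blast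
    qed (use v in \<open>auto simp: Q_carrier_def\<close>)
  next
    fix v assume "v \<in> {Zero_hat} \<union> Elem ` {x. x \<le> 2 * n + 3 \<and> (even x \<or> x = 1)}"
    then consider "v = Zero_hat" | "v = Elem 0" | "v = Elem 1" | i where "v = Elem (2 * i + 2)" "i \<le> n"
    proof -
      assume v: "v \<in> {Zero_hat} \<union> Elem ` {x. x \<le> 2 * n + 3 \<and> (even x \<or> x = 1)}"
        and *: "v = Zero_hat \<Longrightarrow> thesis" "v = Elem 0 \<Longrightarrow> thesis" "v = Elem 1 \<Longrightarrow> thesis"
          "\<And>i. v = Elem (2 * i + 2) \<Longrightarrow> i \<le> n \<Longrightarrow> thesis"
      have "x = 0 \<or> x = 1 \<or> (\<exists>i\<le>n. x = 2 * i + 2)" if "x \<le> 2 * n + 3" "even x \<or> x = 1" for x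
        using that by presburger
      then show thesis using v * by blast
    qed
    then show "v \<in> Q_carrier w"
    proof cases
      case 3
      then show ?thesis using single[of 1 0] snake_covers_one_two(1) by (simp add: snake_carrier_def)
    next
      case (4 i)
      have "\<exists>z. \<forall>z'. (2 * i + 2, z') \<in> snake_covers w n \<longleftrightarrow> z' = z"
      proof (cases i)
        case 0
        then show ?thesis using snake_covers_one_two(2)[of _ w n] by (auto simp: numeral_2_eq_2)
      next
        case (Suc j)
        then have "1 \<le> i" by simp
        then show ?thesis using snake_covers_even[OF _ 4(2)] by blast
      qed
      then show ?thesis using 4 single[of "2 * i + 2"]
        by (auto simp: snake_carrier_def)
    qed (use bot top in simp_all)
  qed
qed

section \<open>Incomparable pairs of meet-irreducible elements\<close>

definition partner :: "nat \<Rightarrow> nat" where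
  "partner i = (if last_turn w i = 0 then 1 else 2 * last_turn w i)"

lemma partner_less: "partner i < 2 * i + 2"
  using last_turn_le[of w i] by (auto simp: partner_def)

lemma incomparable_iff:
  assumes "i \<le> n" "x < 2 * i + 2" "even x \<or> x = 1"
  shows "(2 * i + 2, x) \<notin> snake_order w \<longleftrightarrow> x = partner i"
proof -
  have "x \<notin> snake_up w i \<longleftrightarrow> x = partner i"
    using assms(2,3) by (auto simp: snake_up_def partner_def elim!: evenE)
  then show ?thesis using snake_order_up(1)[OF assms(1)] by simp
qed

text \<open>\<open>Zero_hat\<close> is comparable with everything, and so are 0 and 1 with each
  other. Hence the larger label of an incomparable pair has the form \<open>2 * i + 2\<close>, and
  \<open>incomparable_iff\<close> identifies the smaller one.\<close>

lemma Q_incomparable_iff: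
  assumes "u \<in> Q_carrier w" "v \<in> Q_carrier w"
  shows "u \<noteq> v \<and> (u, v) \<notin> Q_order w \<and> (v, u) \<notin> Q_order w \<longleftrightarrow>
    (\<exists>i\<le>n. {u, v} = {Elem (2 * i + 2), Elem (partner i)})"
proof -
  have Qo: "(a, b) \<in> Q_order w \<longleftrightarrow> (a, b) \<in> hle" if "a \<in> Q_carrier w" "b \<in> Q_carrier w" for a b
    using that by (auto simp: Q_order_def)
  have bot: "(Zero_hat, a) \<in> hle" if "a \<in> Q_carrier w" for a
    using that by (auto simp: hat_order_def Q_carrier_def)
  have *: "(Elem x, Elem y) \<notin> hle \<and> (Elem y, Elem x) \<notin> hle \<longleftrightarrow>
      (\<exists>i\<le>n. {Elem x, Elem y} = {Elem (2 * i + 2), Elem (partner i)})"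
    if "x \<le> 2 * n + 3" "even x \<or> x = 1" "even y \<or> y = 1" "y < x" for x y
  proof (cases "x = 1")
    case True
    then have "(x, y) \<in> snake_order w" using snake_order_one \<open>y < x\<close> by simp
    moreover have "2 * i + 2 \<noteq> x" "2 * i + 2 \<noteq> y" for i using True \<open>y < x\<close> by auto
    ultimately show ?thesis using hle_Elem by (auto simp: doubleton_eq_iff)
  next
    case False
    then have "x = 2 * ((x - 2) div 2) + 2" "(x - 2) div 2 \<le> n" using that by presburger+
    then obtain i where i: "x = 2 * i + 2" "i \<le> n" by blast
    have "(y, x) \<notin> snake_order w" using snake_order_le that(4) by fastforce
    moreover have "(x, y) \<notin> snake_order w \<longleftrightarrow> y = partner i"
      using incomparable_iff[of i y] i that by simp
    \<comment> \<open>A partner is smaller than its even label, so the two labels can be matched in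
      one way only and \<open>j\<close> must be \<open>i\<close>.\<close>
    moreover have "(\<exists>j\<le>n. {Elem x, Elem y} = {Elem (2 * j + 2), Elem (partner j)}) \<longleftrightarrow> y = partner i"
    proof
      assume "\<exists>j\<le>n. {Elem x, Elem y} = {Elem (2 * j + 2), Elem (partner j)}"
      then obtain j where "x = 2 * j + 2 \<and> y = partner j \<or> x = partner j \<and> y = 2 * j + 2"
        by (auto simp: doubleton_eq_iff)
      then have "x = 2 * j + 2 \<and> y = partner j" using partner_less[of j] that(4) by auto
      then show "y = partner i" using i by simp
    qed (use i in blast)
    ultimately show ?thesis using hle_Elem by simp
  qed
  show ?thesis
  proof (cases "u = Zero_hat \<or> v = Zero_hat")
    case True
    then show ?thesis using bot Qo assms by (auto simp: doubleton_eq_iff)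
  next
    case False
    then obtain x y where xy: "u = Elem x" "v = Elem y"
      and x: "x \<le> 2 * n + 3" "even x \<or> x = 1" and y: "y \<le> 2 * n + 3" "even y \<or> y = 1"
      using assms unfolding Q_carrier_eq by blast
    show ?thesis
    proof (cases x y rule: linorder_cases)
      case less
      then show ?thesis using *[OF y(1,2) x(2)] xy Qo assms by (simp add: insert_commute conj_commute)
    next
      case equal
      then show ?thesis using xy partner_less by (auto simp: doubleton_eq_iff) (metis less_irrefl)
    next
      case greater
      then show ?thesis using *[OF x(1,2) y(2)] xy Qo assms by simp
    qed
  qed
qed

lemma Q_finite_poset: "finite_poset (Q_carrier w) (Q_order w)"
proof
  show "finite (Q_carrier w)" unfolding Q_carrier_eq by simp
  show "antisym (Q_order w)"
    using antisym_hle unfolding Q_order_def by (rule antisym_subset[rotated]) auto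
  show "trans (Q_order w)"
    using trans_hle unfolding Q_order_def by (auto simp: trans_def)
qed

text \<open>Of three pairwise incomparable elements, the one with the largest label would have two
  different partners.\<close>

lemma Q_width_two:
  assumes "a \<in> Q_carrier w" "b \<in> Q_carrier w" "a \<noteq> b" "(a, b) \<notin> Q_order w" "(b, a) \<notin> Q_order w"
    and x: "x \<in> Q_carrier w" "x \<noteq> a" "x \<noteq> b"
  shows "(x, a) \<in> Q_order w \<or> (a, x) \<in> Q_order w \<or> (x, b) \<in> Q_order w \<or> (b, x) \<in> Q_order w"
proof (rule ccontr)
  assume not: "\<not> ?thesis"
  obtain i where i: "{a, b} = {Elem (2 * i + 2), Elem (partner i)}"
    using Q_incomparable_iff[OF assms(1,2)] assms by blast
  obtain j where j: "{a, x} = {Elem (2 * j + 2), Elem (partner j)}"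
    using Q_incomparable_iff[OF assms(1) x(1)] not x by blast
  obtain k where k: "{b, x} = {Elem (2 * k + 2), Elem (partner k)}"
    using Q_incomparable_iff[OF assms(2) x(1)] not x by blast
  show False
    using i j k partner_less[of i] partner_less[of j] partner_less[of k] assms(3) x(2,3)
    by (auto simp: doubleton_eq_iff)
qed

text \<open>The larger label of a pair determines its index, so the pairs for
  \<open>i = 0, ..., n\<close> are distinct.\<close>

lemma card_Q_incomparable:
  "card {{a, b} | a b. a \<in> Q_carrier w \<and> b \<in> Q_carrier w \<and> a \<noteq> b \<and>
      (a, b) \<notin> Q_order w \<and> (b, a) \<notin> Q_order w} = n + 1" (is "card ?E = _")
proof -
  define f where "f i = {Elem (2 * i + 2), Elem (partner i)}" for i
  have Q: "Elem (2 * i + 2) \<in> Q_carrier w" "Elem (partner i) \<in> Q_carrier w" if "i \<le> n" for i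
    using that partner_less[of i] unfolding Q_carrier_eq by (auto simp: partner_def)
  have "?E = f ` {..n}"
  proof (intro equalityI subsetI)
    fix e assume "e \<in> ?E"
    then show "e \<in> f ` {..n}" using Q_incomparable_iff by (fastforce simp: f_def)
  next
    fix e assume "e \<in> f ` {..n}"
    then obtain i where i: "i \<le> n" "e = f i" by auto
    then show "e \<in> ?E"
      using Q_incomparable_iff[OF Q[OF i(1)]] Q[OF i(1)] unfolding f_def by blast
  qed
  moreover have "inj_on f {..n}"
  proof (rule inj_onI)
    fix i j assume "f i = f j"
    then show "i = j"
      using partner_less[of i] partner_less[of j] by (auto simp: f_def doubleton_eq_iff)
  qed
  ultimately show ?thesis by (simp add: card_image)
qed

end

theorem theorem5p1:
  fixes w :: "letter list" and k :: nat
  assumes "w \<in> snake_words" and "length w = k"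
  shows "number_of_flips (order_polytope (Q_carrier w) (Q_order w))
           (canonical_triangulation (Q_carrier w) (Q_order w)) = k + 1"
  using number_of_flips_width_two[OF Q_finite_poset Q_width_two, of w] card_Q_incomparable[of w] assms(2)
  by simp

end
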